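(* Let $\alpha,\beta,b>0$ and $q=\alpha+\beta$. Let $\pi_0$ and $\tilde\pi_0$ be probability densities on $(0,\infty)$ such that (1) $\pi_0(x)\propto x^{q-1}\int_0^\infty \lambda^q e^{-\lambda x}\,dU_0(\lambda)$, $x>0$, for some probability measure $U_0$ with support $[u_0,o_0]\subset(0,\infty)$; (2) the density $h_0:=\tilde\pi_0/\pi_0$ is Lipschitz continuous and $h_0\ge H>0$ for some constant $H$. Let $(X_n)_{n\ge 0}$, $(Y_n)_{n\ge1}$ be the hidden Markov model $X_n=bX_{n-1}W_n$, $Y_n=X_n^{-1}G_n$ with (true) initial distribution $X_0\sim\tilde\pi_0$, and let $\pi_n^{y_{1:n}}$ and $\tilde\pi_n^{y_{1:n}}$ be the optimal filters with respect to the initial conditions $\pi_0$ and $\tilde\pi_0$, respectively. Put $$\bar B=\frac{o_0-u_0}{2}\left(\beta(\beta+1)-\frac{2\beta^2u_0}{o_0}+\frac{\beta(\beta+1)o_0^2}{u_0^2}\right)^{1/2}.$$ Then for every $p\in\left(0,-\frac{u_0}{\bar B}\ln E(W_1^\beta)\right)$ (the interval being read as $(0,\infty)$ if $\bar B=0$), $$E\left(\|\pi_n^{Y_{1:n}}-\tilde\pi_n^{Y_{1:n}}\|_{var}^p\right)=\mathcal O(\rho^n),\qquad n\to\infty,\qquad\text{where }\ \rho=\left(E(W_1^\beta)\,e^{p\bar B/u_0}\right)^{\frac{p}{p+\beta}} .$$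
   Context: Hidden Markov model: $X_n=bX_{n-1}W_n$, $Y_n=X_n^{-1}G_n$, $n\in\mathbb N=\{1,2,\dots\}$, where the $W_n$ are i.i.d. $\mathrm{Beta}(\alpha,\beta)$-distributed, the $G_n$ are i.i.d. $\Gamma(1,\beta)$-distributed, and $X_0>0$, $(W_n)_n$, $(G_n)_n$ are independent. Here $\Gamma(\lambda,r)$ denotes the Gamma distribution with rate $\lambda$ and shape $r$, with density $\frac{\lambda^r}{\Gamma(r)}x^{r-1}e^{-\lambda x}$ on $(0,\infty)$. The transition density of the signal is $p(x,y)=\frac{(bx)^{1-q}}{\mathrm{B}(\alpha,\beta)}y^{\alpha-1}(bx-y)^{\beta-1}\mathbf 1_{[0,bx]}(y)$ with $\mathrm B$ the Beta function, and the conditional density of $Y_n$ given $X_n=x$ is $g(x,y)=\frac{x^\beta}{\Gamma(\beta)}y^{\beta-1}e^{-xy}$, $y>0$. Optimal filter: given an initial density $\pi_0$ and observations $y_{1:n}=(y_1,\dots,y_n)\in(0,\infty)^n$, $\pi_n^{y_{1:n}}$ (the conditional distribution of $X_n$ given $Y_{1:n}=y_{1:n}$ when $X_0\sim\pi_0$) is the probability density defined by $\pi_0^{y_{1:0}}=\pi_0$ and $$\pi_{n+1}^{y_{1:n+1}}(x)=\frac{g(x,y_{n+1})\int_0^\infty p(s,x)\pi_n^{y_{1:n}}(s)\,ds}{\int_0^\infty g(z,y_{n+1})\int_0^\infty p(s,z)\pi_n^{y_{1:n}}(s)\,ds\,dz},\qquad x>0;$$ $\tilde\pi_n^{y_{1:n}}$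 is defined in the same way starting from $\tilde\pi_0$. $\pi_n^{Y_{1:n}}$ denotes the filter evaluated at the random observations, and $E$ is the expectation with respect to these. The symbol $\propto$ means equality up to a normalizing constant. $\|\mu-\nu\|_{var}=\sup_A|\mu(A)-\nu(A)|$ (so it is bounded by 1). *)

theory Defs
  imports "HOL-Probability.Probability" "HOL-Library.Landau_Symbols"
begin

definition beta_density :: "real \<Rightarrow> real \<Rightarrow> real \<Rightarrow> real" where
  "beta_density \<alpha> \<beta> x =
     indicator {0<..<1} x * (x powr (\<alpha> - 1) * (1 - x) powr (\<beta> - 1) / Beta \<alpha> \<beta>)"

text \<open>The first parameter is the rate, the second one the shape.\<close>

definition gamma_density :: "real \<Rightarrow> real \<Rightarrow> real \<Rightarrow> real" where
  "gamma_density l r x =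
     indicator {0<..} x * (l powr r / Gamma r * x powr (r - 1) * exp (- l * x))"

text \<open>Densities on \<open>(0,\<infinity>)\<close> are functions on \<open>real\<close> whose values on \<open>(-\<infinity>,0]\<close> are ignored.\<close>

definition prob_density_pos :: "(real \<Rightarrow> real) \<Rightarrow> bool" where
  "prob_density_pos f \<longleftrightarrow>
     (\<forall>x>0. 0 \<le> f x) \<and> set_integrable lborel {0<..} f \<and> (LINT x:{0<..}|lborel. f x) = 1"

definition measure_pos :: "(real \<Rightarrow> real) \<Rightarrow> real measure" where
  "measure_pos f = density lborel (\<lambda>x. ennreal (indicator {0<..} x * f x))"

definition tv_dist :: "real measure \<Rightarrow> real measure \<Rightarrow> real" where
  "tv_dist \<mu> \<nu> = (SUP A\<in>sets borel. \<bar>measure \<mu> A - measure \<nu> A\<bar>)"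

definition measure_support :: "'a::topological_space measure \<Rightarrow> 'a set" where
  "measure_support \<mu> = {x. \<forall>N. open N \<and> x \<in> N \<longrightarrow> 0 < emeasure \<mu> N}"

text \<open>
  The hidden Markov model on the probability space \<open>M\<close>, with \<open>f\<^sub>0\<close> the density of \<open>X 0\<close>
  on \<open>(0,\<infinity>)\<close>. The values \<open>W 0\<close>, \<open>G 0\<close> and \<open>Y 0\<close> are irrelevant. That
  \<open>(W\<^sub>n)\<close> and \<open>(G\<^sub>n)\<close> are sequences of independent variables and that \<open>X\<^sub>0\<close>, \<open>(W\<^sub>n)\<close>,
  \<open>(G\<^sub>n)\<close> are independent of each other is expressed as the independence of the single
  family of all these variables.
\<close>

datatype noise_index = Init | Signal nat | Obs nat

locale gamma_beta_hmm = prob_space M for M :: "'a measure" +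
  fixes \<alpha> \<beta> b :: real
    and f\<^sub>0 :: "real \<Rightarrow> real"
    and X W G Y :: "nat \<Rightarrow> 'a \<Rightarrow> real"
  assumes distr_X0: "distributed M lborel (X 0) (\<lambda>x. ennreal (indicator {0<..} x * f\<^sub>0 x))"
    and distr_W: "\<And>n. n \<ge> 1 \<Longrightarrow> distributed M lborel (W n) (\<lambda>x. ennreal (beta_density \<alpha> \<beta> x))"
    and distr_G: "\<And>n. n \<ge> 1 \<Longrightarrow> distributed M lborel (G n) (\<lambda>x. ennreal (gamma_density 1 \<beta> x))"
    and indep: "indep_vars (\<lambda>_. borel) (case_noise_index (X 0) W G)
                  ({Init} \<union> Signal ` {1..} \<union> Obs ` {1..})"
    and signal: "\<And>n \<omega>. n \<ge> 1 \<Longrightarrow> \<omega> \<in> space M \<Longrightarrow> X n \<omega> = b * X (n - 1) \<omega> * W n \<omega>"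
    and observation: "\<And>n \<omega>. n \<ge> 1 \<Longrightarrow> \<omega> \<in> space M \<Longrightarrow> Y n \<omega> = inverse (X n \<omega>) * G n \<omega>"

definition transition_density :: "real \<Rightarrow> real \<Rightarrow> real \<Rightarrow> real \<Rightarrow> real \<Rightarrow> real" where
  "transition_density \<alpha> \<beta> b x y =
     (b * x) powr (1 - (\<alpha> + \<beta>)) / Beta \<alpha> \<beta> * y powr (\<alpha> - 1) * (b * x - y) powr (\<beta> - 1)
       * indicator {0..b * x} y"

definition obs_density :: "real \<Rightarrow> real \<Rightarrow> real \<Rightarrow> real" where
  "obs_density \<beta> x y =
     indicator {0<..} y * (x powr \<beta> / Gamma \<beta> * y powr (\<beta> - 1) * exp (- x * y))"

text \<open>
  \<open>opt_filter \<alpha> \<beta> b f y n\<close> is the filter density after the observations \<open>y 1, \<dots>, y n\<close>,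
  started from the initial density \<open>f\<close>; it does not depend on the other values of \<open>y\<close>.
\<close>

primrec opt_filter ::
  "real \<Rightarrow> real \<Rightarrow> real \<Rightarrow> (real \<Rightarrow> real) \<Rightarrow> (nat \<Rightarrow> real) \<Rightarrow> nat \<Rightarrow> real \<Rightarrow> real" where
  "opt_filter \<alpha> \<beta> b f y 0 = f"
| "opt_filter \<alpha> \<beta> b f y (Suc n) = (\<lambda>x.
     obs_density \<beta> x (y (Suc n))
       * (LINT s:{0<..}|lborel. transition_density \<alpha> \<beta> b s x * opt_filter \<alpha> \<beta> b f y n s)
     / (LINT z:{0<..}|lborel. obs_density \<beta> z (y (Suc n))
       * (LINT s:{0<..}|lborel. transition_density \<alpha> \<beta> b s z * opt_filter \<alpha> \<beta> b f y n s)))"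

definition B_bar :: "real \<Rightarrow> real \<Rightarrow> real \<Rightarrow> real" where
  "B_bar \<beta> u\<^sub>0 o\<^sub>0 = (o\<^sub>0 - u\<^sub>0) / 2
     * sqrt (\<beta> * (\<beta> + 1) - 2 * \<beta>\<^sup>2 * u\<^sub>0 / o\<^sub>0 + \<beta> * (\<beta> + 1) * o\<^sub>0\<^sup>2 / u\<^sub>0\<^sup>2)"

end

theory Submission
  imports Defs
begin

text \<open>
  The filter preserves mixtures of Gamma densities of shape \<open>q = \<alpha> + \<beta>\<close>. One step moves the rate from \<open>l\<close> to
  \<open>l / b + y\<close>, reweights the mixing measure, and turns a tilt \<open>\<phi> l x\<close> of the components into
  \<open>E (\<phi> l (x / b + T))\<close> with \<open>T\<close> Gamma distributed of rate \<open>l\<close> and shape \<open>\<beta>\<close>. Both filters thus have the same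
  mixing measure, and the tilts are \<open>1\<close> and, starting from the Lipschitz function \<open>h\<^sub>0\<close>, a function whose
  Lipschitz constant is \<open>L / b ^ n\<close> and whose value at \<open>0\<close> has moved by at most \<open>n * L * \<beta> / u\<^sub>0\<close>.

  All rates lie in an interval of length \<open>(o\<^sub>0 - u\<^sub>0) / b ^ n\<close> above \<open>Y n\<close>, so the components are close to each other
  and concentrated near \<open>0\<close>, where the tilt is almost constant. This bounds the distance of the filters by
  \<open>\<kappa> n / (b ^ n * Y n)\<close> with \<open>\<kappa> n\<close> affine in \<open>n\<close>, and constant if \<open>o\<^sub>0 = u\<^sub>0\<close>. Here \<open>b ^ n * Y n\<close> is
  \<open>G n\<close> divided by \<open>X 0 * W 1 * \<dots> * W n\<close>, and it is below \<open>t\<close> with probability \<open>O(t powr \<beta> * E (W 1 powr \<beta>) ^ n)\<close>.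
  Optimizing over \<open>t\<close> gives the rate, and the growth of \<open>\<kappa> n\<close> is absorbed by the exponential factor in \<open>\<rho>\<close>.
\<close>

section \<open>Gamma densities\<close>

lemma gamma_density_nonneg: "r > 0 \<Longrightarrow> 0 \<le> gamma_density l r x"
  unfolding gamma_density_def by (auto intro!: mult_nonneg_nonneg divide_nonneg_nonneg Gamma_real_nonneg)

lemma gamma_density_nonpos: "x \<le> 0 \<Longrightarrow> gamma_density l r x = 0"
  unfolding gamma_density_def by auto

lemma measurable_gamma_density [measurable (raw)]:
  assumes [measurable]: "f \<in> borel_measurable N" "g \<in> borel_measurable N"
  shows "(\<lambda>x. gamma_density (f x) r (g x)) \<in> borel_measurable N"
  unfolding gamma_density_def by measurable

lemma nn_integral_gamma_density:
  assumes "r > 0" "l > 0"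
  shows "(\<integral>\<^sup>+x. ennreal (gamma_density l r x) \<partial>lborel) = 1"
proof -
  define f where "f t = ennreal (indicator {0..} t * t powr (r - 1) / exp t)" for t :: real
  have [measurable]: "f \<in> borel_measurable borel" unfolding f_def by measurable
  have "ennreal (Gamma r) = (\<integral>\<^sup>+x. f x \<partial>lborel)"
    using Gamma_conv_nn_integral_real[OF assms(1)] by (simp add: f_def)
  also have "\<dots> = \<bar>l\<bar> * (\<integral>\<^sup>+x. f (0 + l * x) \<partial>lborel)"
    using assms by (intro nn_integral_real_affine) auto
  also have "\<dots> = (\<integral>\<^sup>+x. ennreal l * f (l * x) \<partial>lborel)"
    using assms by (simp add: nn_integral_cmult)
  also have "\<dots> = (\<integral>\<^sup>+x. ennreal (Gamma r) * ennreal (gamma_density l r x) \<partial>lborel)"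
  proof (rule nn_integral_cong)
    fix x :: real
    have "l * (indicator {0..} (l * x) * (l * x) powr (r - 1) / exp (l * x)) = Gamma r * gamma_density l r x"
    proof (cases "x > 0")
      case True
      have "l * (l * x) powr (r - 1) = l powr r * x powr (r - 1)"
        using assms True by (simp add: powr_mult powr_diff)
      then show ?thesis using True assms less_imp_neq[OF Gamma_real_pos[of r]]
        by (auto simp: gamma_density_def exp_minus field_simps)
    next
      case False
      have "l * x < 0 \<or> x = 0" using False assms by (auto simp: mult_less_0_iff)
      then show ?thesis using False by (auto simp: gamma_density_def)
    qed
    then show "ennreal l * f (l * x) = ennreal (Gamma r) * ennreal (gamma_density l r x)"
      unfolding f_def using assms Gamma_real_pos[of r] by (simp flip: ennreal_mult')
  qed
  also have "\<dots> = ennreal (Gamma r) * (\<integral>\<^sup>+x. ennreal (gamma_density l r x) \<partial>lborel)"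
    by (simp add: nn_integral_cmult)
  finally have "ennreal (Gamma r) * 1 = ennreal (Gamma r) * (\<integral>\<^sup>+x. ennreal (gamma_density l r x) \<partial>lborel)"
    by simp
  then show ?thesis
    using Gamma_real_pos[OF assms(1)] by (subst (asm) ennreal_mult_cancel_left) auto
qed

text \<open>Multiplication by \<open>x powr k\<close> turns the density of shape \<open>r\<close>
  into a constant multiple of the density of shape \<open>r + k\<close> with the same rate.\<close>

lemma nn_integral_gamma_density_moment:
  assumes "r > 0" "l > 0" "k \<ge> 0"
  shows "(\<integral>\<^sup>+x. ennreal (x powr k * gamma_density l r x) \<partial>lborel)
         = ennreal (Gamma (r + k) / (Gamma r * l powr k))"
proof -
  have "x powr k * gamma_density l r x
        = Gamma (r + k) / (Gamma r * l powr k) * gamma_density l (r + k) x" for x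
    using assms less_imp_neq[OF Gamma_real_pos[of r]] less_imp_neq[OF Gamma_real_pos[of "r + k"]]
    by (auto simp: gamma_density_def powr_add powr_diff field_simps split: split_indicator)
  then have "(\<integral>\<^sup>+x. ennreal (x powr k * gamma_density l r x) \<partial>lborel)
     = (\<integral>\<^sup>+x. ennreal (Gamma (r + k) / (Gamma r * l powr k)) * ennreal (gamma_density l (r + k) x) \<partial>lborel)"
    using assms Gamma_real_pos[of r] Gamma_real_pos[of "r + k"]
    by (intro nn_integral_cong) (simp add: ennreal_mult'[symmetric] gamma_density_nonneg)
  also have "\<dots> = ennreal (Gamma (r + k) / (Gamma r * l powr k))"
    using assms by (simp add: nn_integral_cmult nn_integral_gamma_density)
  finally show ?thesis .
qed

lemma nn_integral_gamma_density_mean: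
  assumes "r > 0" "l > 0"
  shows "(\<integral>\<^sup>+x. ennreal (x * gamma_density l r x) \<partial>lborel) = ennreal (r / l)"
proof -
  have "(\<integral>\<^sup>+x. ennreal (x * gamma_density l r x) \<partial>lborel)
        = (\<integral>\<^sup>+x. ennreal (x powr 1 * gamma_density l r x) \<partial>lborel)"
  proof (rule nn_integral_cong)
    fix x :: real
    show "ennreal (x * gamma_density l r x) = ennreal (x powr 1 * gamma_density l r x)"
      by (cases "x > 0") (auto simp: gamma_density_nonpos)
  qed
  also have "\<dots> = ennreal (Gamma (r + 1) / (Gamma r * l powr 1))"
    using assms by (intro nn_integral_gamma_density_moment) auto
  also have "Gamma (r + 1) / (Gamma r * l powr 1) = r / l"
    using assms less_imp_neq[OF Gamma_real_pos[of r]] Gamma_plus1[of r] nonpos_Ints_nonpos[of r] by force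
  finally show ?thesis .
qed

lemma gamma_density_integrable:
  assumes "r > 0" "l > 0"
  shows "integrable lborel (gamma_density l r)" "(LINT x|lborel. gamma_density l r x) = 1"
  using assms nn_integral_gamma_density[OF assms]
  by (auto intro!: integrableI_nn_integral_finite[where x = 1] simp: integral_eq_nn_integral gamma_density_nonneg)

lemma gamma_density_mean_integrable:
  assumes "r > 0" "l > 0"
  shows "integrable lborel (\<lambda>x. x * gamma_density l r x)"
    and "(LINT x|lborel. x * gamma_density l r x) = r / l"
proof -
  have nn: "0 \<le> x * gamma_density l r x" for x
    using assms by (cases "x > 0") (auto simp: gamma_density_nonpos gamma_density_nonneg)
  show "integrable lborel (\<lambda>x. x * gamma_density l r x)"
    using assms nn_integral_gamma_density_mean[OF assms] nn
    by (intro integrableI_nn_integral_finite[where x = "r / l"]) auto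
  show "(LINT x|lborel. x * gamma_density l r x) = r / l"
    using assms nn_integral_gamma_density_mean[OF assms] nn
    by (subst integral_eq_nn_integral) auto
qed

lemma lipschitz_on_UNIV_abs_diff_le:
  fixes f :: "real \<Rightarrow> real"
  assumes "L-lipschitz_on UNIV f"
  shows "\<bar>f x - f y\<bar> \<le> L * \<bar>x - y\<bar>"
  using lipschitz_onD[OF assms, of x y] by (simp add: dist_real_def)

text \<open>Powers of the rates and exponentials are compared separately: passing to the larger rate
  \<open>v\<close> lowers the exponential, and \<open>(u / v) powr r\<close> pays for the larger
  power. This yields the common part of all components in
  \<open>gamma_part_oscillation\<close>.\<close>

lemma gamma_density_ratio_lower:
  assumes "0 < u" "u \<le> l" "l \<le> v" "r > 0"
  shows "(u / v) powr r * gamma_density v r x \<le> gamma_density l r x"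
proof (cases "x > 0")
  case True
  have "(u / v) powr r * v powr r * exp (- v * x) \<le> l powr r * exp (- l * x)"
  proof (rule mult_mono)
    show "(u / v) powr r * v powr r \<le> l powr r"
      using assms by (simp flip: powr_mult add: powr_mono2)
  qed (use assms True in auto)
  moreover have "gamma_density t r x = (x powr (r - 1) / Gamma r) * (t powr r * exp (- t * x))" for t
    using True by (simp add: gamma_density_def)
  moreover have "0 \<le> x powr (r - 1) / Gamma r"
    using assms by (auto intro!: divide_nonneg_nonneg Gamma_real_nonneg)
  ultimately show ?thesis
    using mult_left_mono[of "(u / v) powr r * v powr r * exp (- v * x)" "l powr r * exp (- l * x)" "x powr (r - 1) / Gamma r"]
    by (simp only: mult_ac)
qed (auto simp: gamma_density_nonpos)

text \<open>Conjugacy of the Gamma family. In the variable \<open>t = s - x / b\<close> the exponent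
  splits and the powers of \<open>s\<close> cancel, so that \<open>x\<close> and \<open>t\<close>
  separate into two Gamma densities. The remaining constant is the factor collected in
  \<open>weight\<close>.\<close>

lemma filter_kernel_gamma_density:
  assumes "\<alpha> > 0" "\<beta> > 0" "b > 0" "l > 0" "y > 0" "x > 0"
  shows "obs_density \<beta> x y * (transition_density \<alpha> \<beta> b s x * gamma_density l (\<alpha> + \<beta>) s)
    = (l / b) powr \<alpha> * y powr (\<beta> - 1) / (Beta \<alpha> \<beta> * (l / b + y) powr (\<alpha> + \<beta>))
        * gamma_density (l / b + y) (\<alpha> + \<beta>) x * gamma_density l \<beta> (s - x / b)"
proof (cases "s > x / b")
  case True
  define t where "t = s - x / b"
  have t: "t > 0" and s: "s = x / b + t" using True by (auto simp: t_def)
  have s0: "s > 0" using True assms by (meson divide_pos_pos less_trans)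
  have bs: "b * s - x = b * t" "x \<le> b * s" using assms True by (auto simp: t_def field_simps)
  have pos: "Gamma \<alpha> > 0" "Gamma \<beta> > 0" "Gamma (\<alpha> + \<beta>) > 0" "l / b + y > 0"
    using assms by (auto intro!: Gamma_real_pos add_pos_pos)
  have e: "exp (- x * y) * exp (- l * s) = exp (- (l / b + y) * x) * exp (- l * t)"
    unfolding s exp_add[symmetric] by (simp add: algebra_simps)
  have p: "(b * s) powr (1 - (\<alpha> + \<beta>)) * s powr (\<alpha> + \<beta> - 1) * (b * t) powr (\<beta> - 1) * l powr (\<alpha> + \<beta>)
      = (l / b) powr \<alpha> * l powr \<beta> * t powr (\<beta> - 1)"
    using assms t s0 by (simp add: powr_mult powr_divide powr_diff powr_add field_simps)
  have x: "x powr \<beta> * x powr (\<alpha> - 1) = x powr (\<alpha> + \<beta> - 1)"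
    using assms by (simp add: powr_add[symmetric] algebra_simps)
  have "obs_density \<beta> x y * (transition_density \<alpha> \<beta> b s x * gamma_density l (\<alpha> + \<beta>) s)
     = y powr (\<beta> - 1) / (Gamma \<beta> * Beta \<alpha> \<beta> * Gamma (\<alpha> + \<beta>)) * (x powr \<beta> * x powr (\<alpha> - 1))
       * ((b * s) powr (1 - (\<alpha> + \<beta>)) * s powr (\<alpha> + \<beta> - 1) * (b * t) powr (\<beta> - 1) * l powr (\<alpha> + \<beta>))
       * (exp (- x * y) * exp (- l * s))"
    using assms s0 bs by (simp add: obs_density_def transition_density_def gamma_density_def mult_ac)
  also have "\<dots> = (l / b) powr \<alpha> * y powr (\<beta> - 1) / (Beta \<alpha> \<beta> * (l / b + y) powr (\<alpha> + \<beta>))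
        * gamma_density (l / b + y) (\<alpha> + \<beta>) x * gamma_density l \<beta> t"
    unfolding e p x using assms t pos by (simp add: gamma_density_def mult_ac)
  finally show ?thesis by (simp add: t_def)
next
  case False
  \<comment> \<open>At \<open>x = b * s\<close> the indicator is still \<open>1\<close>; the density
    vanishes there, even for \<open>\<beta> < 1\<close>, because \<open>0 powr a = 0\<close> by
    convention.\<close>
  then have "transition_density \<alpha> \<beta> b s x = 0"
    using assms by (cases "x = b * s") (auto simp: transition_density_def field_simps)
  then show ?thesis using False by (simp add: gamma_density_nonpos)
qed

text \<open>These facts describe one step of the recursion for \<open>tilt\<close>, averaging over a
  Gamma distributed shift. Each bound is the Lipschitz or lower bound taken under the integral;
  \<open>r / l\<close> is the mean shift.\<close>

lemma gamma_density_lipschitz: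
  fixes f :: "real \<Rightarrow> real"
  assumes lip: "K-lipschitz_on UNIV f" and r: "r > 0" and l: "l > 0"
  shows gamma_density_lipschitz_integrable: "integrable lborel (\<lambda>t. gamma_density l r t * f (c + t))"
    and gamma_density_lipschitz_shift: "\<bar>(LINT t|lborel. gamma_density l r t * f (c + t)) - f c\<bar> \<le> K * (r / l)"
    and gamma_density_lipschitz_diff:
      "\<bar>(LINT t|lborel. gamma_density l r t * f (c + t)) - (LINT t|lborel. gamma_density l r t * f (d + t))\<bar> \<le> K * \<bar>c - d\<bar>"
    and gamma_density_lipschitz_lower: "(\<And>x. H \<le> f x) \<Longrightarrow> H \<le> (LINT t|lborel. gamma_density l r t * f (c + t))"
proof -
  have [measurable]: "f \<in> borel_measurable borel"
    by (intro borel_measurable_continuous_onI lipschitz_on_continuous_on[OF lip])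
  note g1 = gamma_density_integrable[OF r l] and g2 = gamma_density_mean_integrable[OF r l]
  have bd: "\<bar>gamma_density l r t * (f (c + t) - f c)\<bar> \<le> K * (t * gamma_density l r t)" for c t
  proof (cases "t > 0")
    case True
    have "gamma_density l r t * \<bar>f (c + t) - f c\<bar> \<le> gamma_density l r t * (K * t)"
      using lipschitz_on_UNIV_abs_diff_le[OF lip, of "c + t" c] True r
      by (intro mult_left_mono gamma_density_nonneg) auto
    then show ?thesis using r by (simp add: abs_mult gamma_density_nonneg mult_ac)
  qed (simp add: gamma_density_nonpos)
  have int0: "integrable lborel (\<lambda>t. gamma_density l r t * (f (c + t) - f c))" for c
  proof (rule Bochner_Integration.integrable_bound)
    show "integrable lborel (\<lambda>t. K * (t * gamma_density l r t))" using g2 by simp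
  qed (use bd in \<open>auto intro!: AE_I2 order_trans[OF bd]\<close>)
  have int: "integrable lborel (\<lambda>t. gamma_density l r t * f (c + t))" for c
    using Bochner_Integration.integrable_add[OF int0[of c] integrable_mult_left[OF g1(1), of "f c"]]
    by (simp add: algebra_simps)
  then show "integrable lborel (\<lambda>t. gamma_density l r t * f (c + t))" .
  have "(LINT t|lborel. gamma_density l r t * f (c + t)) - f c
      = (LINT t|lborel. gamma_density l r t * f (c + t)) - (LINT t|lborel. gamma_density l r t * f c)"
    using g1 by simp
  also have "\<dots> = (LINT t|lborel. gamma_density l r t * (f (c + t) - f c))"
    using int[of c] g1 by (subst Bochner_Integration.integral_diff[symmetric]) (auto simp: algebra_simps)
  also have "\<bar>\<dots>\<bar> \<le> (LINT t|lborel. K * (t * gamma_density l r t))"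
    using int0 g2 bd by (intro order_trans[OF integral_abs_bound] integral_mono) auto
  also have "\<dots> = K * (r / l)" using g2 by simp
  finally show "\<bar>(LINT t|lborel. gamma_density l r t * f (c + t)) - f c\<bar> \<le> K * (r / l)" .
  have "(LINT t|lborel. gamma_density l r t * f (c + t)) - (LINT t|lborel. gamma_density l r t * f (d + t))
      = (LINT t|lborel. gamma_density l r t * f (c + t) - gamma_density l r t * f (d + t))"
    using int by simp
  also have "\<bar>\<dots>\<bar> \<le> (LINT t|lborel. gamma_density l r t * (K * \<bar>c - d\<bar>))"
  proof (intro order_trans[OF integral_abs_bound] integral_mono)
    fix t
    have "gamma_density l r t * \<bar>f (c + t) - f (d + t)\<bar> \<le> gamma_density l r t * (K * \<bar>c - d\<bar>)"
      using lipschitz_on_UNIV_abs_diff_le[OF lip, of "c + t" "d + t"] r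
      by (intro mult_left_mono gamma_density_nonneg) auto
    then show "\<bar>gamma_density l r t * f (c + t) - gamma_density l r t * f (d + t)\<bar>
        \<le> gamma_density l r t * (K * \<bar>c - d\<bar>)"
      using r by (simp add: abs_mult gamma_density_nonneg right_diff_distrib[symmetric])
  qed (use int g1 in auto)
  also have "\<dots> = K * \<bar>c - d\<bar>" using g1 by simp
  finally show "\<bar>(LINT t|lborel. gamma_density l r t * f (c + t)) - (LINT t|lborel. gamma_density l r t * f (d + t))\<bar>
      \<le> K * \<bar>c - d\<bar>" .
  assume H: "\<And>x. H \<le> f x"
  have "H = (LINT t|lborel. gamma_density l r t * H)" using g1 by simp
  also have "\<dots> \<le> (LINT t|lborel. gamma_density l r t * f (c + t))"
    using g1 int H r by (intro integral_mono mult_left_mono gamma_density_nonneg) auto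
  finally show "H \<le> (LINT t|lborel. gamma_density l r t * f (c + t))" .
qed

section \<open>Rates, weights and tilts\<close>

primrec rate :: "real \<Rightarrow> (nat \<Rightarrow> real) \<Rightarrow> nat \<Rightarrow> real \<Rightarrow> real" where
  "rate b y 0 l = l"
| "rate b y (Suc n) l = rate b y n l / b + y (Suc n)"

text \<open>Unnormalized density of the mixing measure with respect to the initial one.\<close>

primrec weight :: "real \<Rightarrow> real \<Rightarrow> real \<Rightarrow> (nat \<Rightarrow> real) \<Rightarrow> nat \<Rightarrow> real \<Rightarrow> real" where
  "weight \<alpha> \<beta> b y 0 l = 1"
| "weight \<alpha> \<beta> b y (Suc n) l = weight \<alpha> \<beta> b y n l
     * ((rate b y n l / b) powr \<alpha> * y (Suc n) powr (\<beta> - 1)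
          / (Beta \<alpha> \<beta> * rate b y (Suc n) l powr (\<alpha> + \<beta>)))"

text \<open>Under the component of initial rate \<open>l\<close>, the previous signal given the
  present value \<open>x\<close> is \<open>x / b\<close> plus a Gamma variable. Hence the tilt at
  time \<open>n\<close> is the conditional expectation of \<open>h\<close> at the initial signal,
  given the value \<open>x\<close> of the signal at time \<open>n\<close> and the observations up to
  \<open>n\<close>.\<close>

primrec tilt :: "real \<Rightarrow> real \<Rightarrow> (nat \<Rightarrow> real) \<Rightarrow> (real \<Rightarrow> real) \<Rightarrow> nat \<Rightarrow> real \<Rightarrow> real \<Rightarrow> real" where
  "tilt \<beta> b y h 0 l x = h x"
| "tilt \<beta> b y h (Suc n) l x =
     (LINT t|lborel. gamma_density (rate b y n l) \<beta> t * tilt \<beta> b y h n l (x / b + t))"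

lemma measurable_rate [measurable (raw)]:
  "f \<in> borel_measurable N \<Longrightarrow> (\<lambda>z. rate b y n (f z)) \<in> borel_measurable N"
  by (induction n) auto

lemma measurable_weight [measurable (raw)]:
  "f \<in> borel_measurable N \<Longrightarrow> (\<lambda>z. weight \<alpha> \<beta> b y n (f z)) \<in> borel_measurable N"
proof (induction n)
  case (Suc n)
  note [measurable] = Suc.IH[OF Suc.prems] Suc.prems
  show ?case unfolding weight.simps by measurable
qed simp

lemma measurable_tilt:
  assumes "h \<in> borel_measurable borel" "f \<in> borel_measurable N" "g \<in> borel_measurable N"
  shows "(\<lambda>z. tilt \<beta> b y h n (f z) (g z)) \<in> borel_measurable N"
proof -
  have "(\<lambda>z. tilt \<beta> b y h n (fst z) (snd z)) \<in> borel_measurable (borel \<Otimes>\<^sub>M borel)"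
  proof (induction n)
    case 0
    then show ?case using assms(1) by simp
  next
    case (Suc n)
    have [measurable]: "(\<lambda>w. tilt \<beta> b y h n (fst (fst w)) (snd (fst w) / b + snd w))
        \<in> borel_measurable ((borel \<Otimes>\<^sub>M borel) \<Otimes>\<^sub>M lborel)"
      using measurable_compose[of "\<lambda>w. (fst (fst w), snd (fst w) / b + snd w)" _ _, OF _ Suc]
      by simp
    show ?case unfolding tilt.simps
      by measurable
  qed
  from measurable_compose[of "\<lambda>z. (f z, g z)", OF _ this] show ?thesis
    using assms by simp
qed

text \<open>The observations shift all rates by the same amount, so the differences of rates are
  those of the initial ones divided by \<open>b ^ n\<close>.\<close>

lemma rate_affine: "rate b y n l = rate b y n 0 + l / b ^ n"
  by (induction n) (auto simp: add_divide_distrib field_simps)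

lemma rate_lower:
  assumes "b > 0" "\<And>n. n \<ge> 1 \<Longrightarrow> y n > 0" "l \<ge> 0"
  shows "l / b ^ n \<le> rate b y n l"
proof -
  have "0 \<le> rate b y n 0" by (induction n) (use assms in \<open>auto simp: less_imp_le add_nonneg_nonneg\<close>)
  then show ?thesis by (subst rate_affine) simp
qed

lemma rate_pos:
  assumes "b > 0" "\<And>n. n \<ge> 1 \<Longrightarrow> y n > 0" "l > 0"
  shows "0 < rate b y n l"
  proof -
  have "0 < l / b ^ n" using assms by simp
  also have "\<dots> \<le> rate b y n l" using assms by (intro rate_lower) auto
  finally show ?thesis .
qed

lemma rate_mono: "b > 0 \<Longrightarrow> l \<le> l' \<Longrightarrow> rate b y n l \<le> rate b y n l'"
  by (subst (1 2) rate_affine) (simp add: divide_right_mono)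

lemma rate_ge_obs:
  assumes "b > 0" "\<And>n. n \<ge> 1 \<Longrightarrow> y n > 0" "l > 0" "n \<ge> 1"
  shows "y n \<le> rate b y n l"
proof -
  obtain m where "n = Suc m" using assms(4) by (cases n) auto
  then show ?thesis using rate_pos[where y = y and l = l and n = m and b = b] assms by (simp add: less_imp_le)
qed

text \<open>The observations \<open>y\<close> are a fixed positive sequence. The mixing measure is
  the image of \<open>U\<close> under \<open>lam\<close>, which lets the bounds on the rates hold at
  every point. Having \<open>h\<close> on the whole line makes its value at \<open>0\<close>
  available as reference point. The constant \<open>h = 1\<close> describes the filter started from
  \<open>\<pi>\<^sub>0\<close>, the extension of \<open>h\<^sub>0\<close> the one started from
  \<open>\<pi>t\<^sub>0\<close>.\<close>

locale gamma_mixture = prob_space U for U :: "'b measure" +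
  fixes lam :: "'b \<Rightarrow> real" and u v \<alpha> \<beta> b L H :: real
    and y :: "nat \<Rightarrow> real" and h :: "real \<Rightarrow> real"
  assumes lam [measurable]: "lam \<in> borel_measurable U"
    and lam_ge: "\<And>l. u \<le> lam l" and lam_le: "\<And>l. lam l \<le> v"
    and u: "0 < u" and \<alpha>: "0 < \<alpha>" and \<beta>: "0 < \<beta>" and b: "0 < b"
    and y: "\<And>n. n \<ge> 1 \<Longrightarrow> 0 < y n"
    and h: "L-lipschitz_on UNIV h" and H: "0 < H" and h_ge: "\<And>x. H \<le> h x"
begin

abbreviation "R n l \<equiv> rate b y n (lam l)"
abbreviation "W n l \<equiv> weight \<alpha> \<beta> b y n (lam l)"
abbreviation "T n l x \<equiv> tilt \<beta> b y h n (lam l) x"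
abbreviation "Rmin n \<equiv> rate b y n u"
abbreviation "Rmax n \<equiv> rate b y n v"

lemma lam_pos: "0 < lam l" using u lam_ge[of l] by linarith

lemma R_pos: "0 < R n l" by (intro rate_pos b y lam_pos)
lemma Rmin_pos: "0 < Rmin n" by (intro rate_pos b y u)
lemma Rmin_le: "Rmin n \<le> R n l" by (intro rate_mono b lam_ge)
lemma Rmax_ge: "R n l \<le> Rmax n" by (intro rate_mono b lam_le)

lemma L_nonneg: "0 \<le> L" using h by (rule lipschitz_on_nonneg)

lemma measurable_h [measurable]: "h \<in> borel_measurable borel"
  by (intro borel_measurable_continuous_onI lipschitz_on_continuous_on[OF h])

lemma measurable_T [measurable (raw)]:
  "f \<in> measurable N U \<Longrightarrow> g \<in> borel_measurable N \<Longrightarrow> (\<lambda>z. T n (f z) (g z)) \<in> borel_measurable N"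
  by (intro measurable_tilt) auto

text \<open>Averaging over the Gamma shift keeps a Lipschitz constant, and the argument
  \<open>x / b\<close> divides it by \<open>b\<close>.\<close>

lemma T_lipschitz: "(L / b ^ n)-lipschitz_on UNIV (T n l)"
proof (induction n)
  case 0
  have "T 0 l = h" by (auto simp: fun_eq_iff)
  then show ?case using h by simp
next
  case (Suc n)
  show ?case
  proof (rule lipschitz_onI)
    fix x x' :: real
    show "dist (T (Suc n) l x) (T (Suc n) l x') \<le> L / b ^ Suc n * dist x x'"
      using gamma_density_lipschitz_diff[OF Suc \<beta> R_pos, of n l "x / b" "x' / b"] b
      by (simp add: dist_real_def diff_divide_distrib[symmetric] mult.commute[of b])
  qed (use b L_nonneg in auto)
qed

lemma T_ge: "H \<le> T n l x"
proof (induction n arbitrary: x)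
  case 0
  then show ?case using h_ge by simp
next
  case (Suc n)
  show ?case unfolding tilt.simps by (rule gamma_density_lipschitz_lower[OF T_lipschitz \<beta> R_pos Suc])
qed

lemma T_pos: "0 < T n l x" using T_ge[of n l x] H by linarith

lemma T_integrable: "integrable lborel (\<lambda>t. gamma_density (R n l) \<beta> t * T n l (c + t))"
  by (rule gamma_density_lipschitz_integrable[OF T_lipschitz \<beta> R_pos])

text \<open>One step moves the value at \<open>0\<close> by at most the Lipschitz constant
  \<open>L / b ^ n\<close> times the mean shift \<open>\<beta> / R n l\<close>. Since
  \<open>R n l \<ge> u / b ^ n\<close>, the powers of \<open>b\<close> cancel and every step costs
  the same amount.\<close>

lemma T_origin: "\<bar>T n l 0 - h 0\<bar> \<le> real n * (L * \<beta> / u)"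
proof (induction n)
  case (Suc n)
  have "\<bar>T (Suc n) l 0 - T n l 0\<bar> \<le> L / b ^ n * (\<beta> / R n l)"
    using gamma_density_lipschitz_shift[OF T_lipschitz \<beta> R_pos, of n l n l 0] by simp
  also have "\<dots> \<le> L / b ^ n * (\<beta> / (u / b ^ n))"
  proof -
    have "u / b ^ n \<le> R n l"
      using rate_lower[where l = u and n = n and b = b and y = y] b y Rmin_le[of n l] u by simp
    then show ?thesis using b u \<beta> L_nonneg R_pos
      by (intro mult_left_mono divide_left_mono mult_pos_pos) auto
  qed
  also have "\<dots> = L * \<beta> / u" using b by simp
  finally have "\<bar>T (Suc n) l 0 - h 0\<bar> \<le> L * \<beta> / u + real n * (L * \<beta> / u)"
    using Suc by linarith
  then show ?case by (simp only: of_nat_Suc distrib_right mult_1)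
qed simp

lemma T_upper: "T n l x \<le> (\<bar>h 0\<bar> + real n * (L * \<beta> / u)) + L / b ^ n * \<bar>x\<bar>"
  using lipschitz_on_UNIV_abs_diff_le[OF T_lipschitz, of n l x 0] T_origin[of n l] by simp

lemma W_pos: "0 < W n l"
proof (induction n)
  case (Suc n)
  have "0 < Beta \<alpha> \<beta>" using \<alpha> \<beta> by (simp add: Beta_def Gamma_real_pos)
  moreover have "0 < R n l / b" using R_pos b by simp
  ultimately show ?case using Suc y[of "Suc n"] R_pos[of "Suc n" l]
    by (auto intro!: mult_pos_pos divide_pos_pos simp: less_imp_neq[symmetric])
qed simp

text \<open>The new rate exceeds both of its summands, so
  \<open>(R n l / b) powr \<alpha> * y (Suc n) powr \<beta>\<close> is at most its power of order
  \<open>\<alpha> + \<beta>\<close>. This bounds each factor of the weight uniformly in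
  \<open>l\<close>.\<close>

lemma W_bounded: "\<exists>K. \<forall>l. W n l \<le> K"
proof (induction n)
  case 0
  then show ?case by auto
next
  case (Suc n)
  then obtain K where K: "\<And>l. W n l \<le> K" by auto
  have Bp: "0 < Beta \<alpha> \<beta>" using \<alpha> \<beta> by (simp add: Beta_def Gamma_real_pos)
  have "W (Suc n) l \<le> K * (1 / (Beta \<alpha> \<beta>) * (y (Suc n) powr (\<beta> - 1) / y (Suc n) powr \<beta>))" for l
  proof -
    have y': "0 < y (Suc n)" and r: "0 < R n l / b" using y R_pos b by auto
    have "(R n l / b) powr \<alpha> * y (Suc n) powr \<beta> \<le> R (Suc n) l powr \<alpha> * R (Suc n) l powr \<beta>"
      using y' r \<alpha> \<beta> by (intro mult_mono powr_mono2) auto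
    also have "\<dots> = R (Suc n) l powr (\<alpha> + \<beta>)" by (simp add: powr_add)
    finally have "(R n l / b) powr \<alpha> / R (Suc n) l powr (\<alpha> + \<beta>) \<le> 1 / y (Suc n) powr \<beta>"
      using y' R_pos[of "Suc n" l] by (simp add: field_simps)
    then have "(R n l / b) powr \<alpha> / R (Suc n) l powr (\<alpha> + \<beta>) * (y (Suc n) powr (\<beta> - 1) / Beta \<alpha> \<beta>)
       \<le> 1 / y (Suc n) powr \<beta> * (y (Suc n) powr (\<beta> - 1) / Beta \<alpha> \<beta>)"
      using Bp by (intro mult_right_mono) auto
    then have "W n l * ((R n l / b) powr \<alpha> / R (Suc n) l powr (\<alpha> + \<beta>) * (y (Suc n) powr (\<beta> - 1) / Beta \<alpha> \<beta>))
       \<le> K * (1 / y (Suc n) powr \<beta> * (y (Suc n) powr (\<beta> - 1) / Beta \<alpha> \<beta>))"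
    proof (rule mult_mono[OF K])
      show "0 \<le> K" using K[of l] W_pos[of n l] by simp
    qed (use Bp in \<open>auto intro!: mult_nonneg_nonneg divide_nonneg_nonneg\<close>)
    then show ?thesis by (simp add: mult_ac)
  qed
  then show ?case by blast
qed

section \<open>The filter as a mixture of Gamma densities\<close>

definition kernel :: "nat \<Rightarrow> 'b \<Rightarrow> real \<Rightarrow> real" where
  "kernel n l x = W n l * (gamma_density (R n l) (\<alpha> + \<beta>) x * T n l x)"

text \<open>The unnormalized filter density. Extended nonnegative values allow the integrals over
  \<open>l\<close> and \<open>x\<close> to be interchanged before any integrability is
  known.\<close>

definition mix :: "nat \<Rightarrow> real \<Rightarrow> ennreal" where
  "mix n x = (\<integral>\<^sup>+l. ennreal (kernel n l x) \<partial>U)"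

definition mass :: "nat \<Rightarrow> ennreal" where
  "mass n = (\<integral>\<^sup>+x. mix n x \<partial>lborel)"

lemma q_pos: "0 < \<alpha> + \<beta>" using \<alpha> \<beta> by simp

lemma measurable_kernel [measurable (raw)]:
  assumes [measurable]: "f \<in> measurable N U" "g \<in> borel_measurable N"
  shows "(\<lambda>z. kernel n (f z) (g z)) \<in> borel_measurable N"
  unfolding kernel_def by measurable

lemma kernel_nonpos: "x \<le> 0 \<Longrightarrow> kernel n l x = 0"
  by (simp add: kernel_def gamma_density_nonpos)

lemma mix_nonpos: "x \<le> 0 \<Longrightarrow> mix n x = 0"
  by (simp add: mix_def kernel_nonpos)

lemma measurable_mix [measurable]: "mix n \<in> borel_measurable borel"
  unfolding mix_def by measurable

text \<open>Finiteness is essential because the filter reads \<open>mix\<close> through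
  \<open>enn2real\<close>, which would send infinity to \<open>0\<close>. For fixed \<open>x\<close>
  the weight is bounded, the component is bounded by dropping its exponential and inserting
  \<open>Rmax n\<close>, and the tilt is bounded by \<open>T_upper\<close>.\<close>

lemma mix_finite: "mix n x < \<infinity>"
proof (cases "x > 0")
  case True
  obtain K where K: "\<And>l. W n l \<le> K" using W_bounded by blast
  define D where "D = (\<bar>h 0\<bar> + real n * (L * \<beta> / u)) + L / b ^ n * \<bar>x\<bar>"
  define E where "E = Rmax n powr (\<alpha> + \<beta>) / Gamma (\<alpha> + \<beta>) * x powr (\<alpha> + \<beta> - 1)"
  have "kernel n l x \<le> K * (E * D)" for l
    unfolding kernel_def
  proof (rule mult_mono[OF K])
    show "gamma_density (R n l) (\<alpha> + \<beta>) x * T n l x \<le> E * D"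
    proof (rule mult_mono)
      have "R n l powr (\<alpha> + \<beta>) / Gamma (\<alpha> + \<beta>) * x powr (\<alpha> + \<beta> - 1) * exp (- R n l * x) \<le> E * 1"
        unfolding E_def
      proof (rule mult_mono)
        show "R n l powr (\<alpha> + \<beta>) / Gamma (\<alpha> + \<beta>) * x powr (\<alpha> + \<beta> - 1)
            \<le> Rmax n powr (\<alpha> + \<beta>) / Gamma (\<alpha> + \<beta>) * x powr (\<alpha> + \<beta> - 1)"
          using R_pos[of n l] Rmax_ge[of n l] q_pos
          by (intro mult_right_mono divide_right_mono powr_mono2 Gamma_real_nonneg) auto
      qed (use True R_pos[of n l] q_pos in
        \<open>auto intro!: mult_nonneg_nonneg divide_nonneg_nonneg Gamma_real_nonneg\<close>)
      then show "gamma_density (R n l) (\<alpha> + \<beta>) x \<le> E"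
        using True by (simp add: gamma_density_def)
      show "T n l x \<le> D" unfolding D_def by (rule T_upper)
      show "0 \<le> E" unfolding E_def using q_pos
        by (auto intro!: mult_nonneg_nonneg divide_nonneg_nonneg Gamma_real_nonneg)
      show "0 \<le> T n l x" using T_pos by (rule less_imp_le)
    qed
    show "0 \<le> K" using K[of l] W_pos[of n l] by simp
    show "0 \<le> gamma_density (R n l) (\<alpha> + \<beta>) x * T n l x"
      using T_pos q_pos by (intro mult_nonneg_nonneg gamma_density_nonneg) (auto intro: less_imp_le)
  qed
  then have "mix n x \<le> (\<integral>\<^sup>+l. ennreal (K * (E * D)) \<partial>U)"
    unfolding mix_def by (intro nn_integral_mono ennreal_leI)
  also have "\<dots> < \<infinity>" by (simp add: emeasure_space_1)
  finally show ?thesis .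
qed (simp add: mix_nonpos)

section \<open>Finite and positive total mass of the mixture\<close>

lemma nn_integral_gamma_T_bounds:
  shows "ennreal H \<le> (\<integral>\<^sup>+x. ennreal (gamma_density (R n l) (\<alpha> + \<beta>) x * T n l x) \<partial>lborel)"
    and "(\<integral>\<^sup>+x. ennreal (gamma_density (R n l) (\<alpha> + \<beta>) x * T n l x) \<partial>lborel)
      \<le> ennreal (\<bar>h 0\<bar> + real n * (L * \<beta> / u) + L / b ^ n * ((\<alpha> + \<beta>) / Rmin n))"
proof -
  have "ennreal H = (\<integral>\<^sup>+x. ennreal H * ennreal (gamma_density (R n l) (\<alpha> + \<beta>) x) \<partial>lborel)"
    using nn_integral_gamma_density[OF q_pos R_pos] by (simp add: nn_integral_cmult)
  also have "\<dots> = (\<integral>\<^sup>+x. ennreal (gamma_density (R n l) (\<alpha> + \<beta>) x * H) \<partial>lborel)"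
    using H q_pos by (simp add: ennreal_mult'' mult.commute gamma_density_nonneg)
  also have "\<dots> \<le> (\<integral>\<^sup>+x. ennreal (gamma_density (R n l) (\<alpha> + \<beta>) x * T n l x) \<partial>lborel)"
    using q_pos by (intro nn_integral_mono ennreal_leI mult_left_mono T_ge gamma_density_nonneg)
  finally show "ennreal H \<le> (\<integral>\<^sup>+x. ennreal (gamma_density (R n l) (\<alpha> + \<beta>) x * T n l x) \<partial>lborel)" .
  define D where "D = \<bar>h 0\<bar> + real n * (L * \<beta> / u)"
  have D: "0 \<le> D" "0 \<le> L / b ^ n" using L_nonneg \<beta> u b by (auto simp: D_def)
  have "(\<integral>\<^sup>+x. ennreal (gamma_density (R n l) (\<alpha> + \<beta>) x * T n l x) \<partial>lborel)
     \<le> (\<integral>\<^sup>+x. ennreal D * ennreal (gamma_density (R n l) (\<alpha> + \<beta>) x)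
            + ennreal (L / b ^ n) * ennreal (x * gamma_density (R n l) (\<alpha> + \<beta>) x) \<partial>lborel)"
  proof (rule nn_integral_mono)
    fix x :: real
    show "ennreal (gamma_density (R n l) (\<alpha> + \<beta>) x * T n l x)
        \<le> ennreal D * ennreal (gamma_density (R n l) (\<alpha> + \<beta>) x)
            + ennreal (L / b ^ n) * ennreal (x * gamma_density (R n l) (\<alpha> + \<beta>) x)"
    proof (cases "x > 0")
      case True
      have g: "0 \<le> gamma_density (R n l) (\<alpha> + \<beta>) x" using q_pos by (rule gamma_density_nonneg)
      have "gamma_density (R n l) (\<alpha> + \<beta>) x * T n l x
          \<le> gamma_density (R n l) (\<alpha> + \<beta>) x * (D + L / b ^ n * x)"
        using T_upper[of n l x] True g by (intro mult_left_mono) (auto simp: D_def)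
      also have "\<dots> = D * gamma_density (R n l) (\<alpha> + \<beta>) x + L / b ^ n * (x * gamma_density (R n l) (\<alpha> + \<beta>) x)"
        by (simp add: algebra_simps)
      finally have "ennreal (gamma_density (R n l) (\<alpha> + \<beta>) x * T n l x)
        \<le> ennreal (D * gamma_density (R n l) (\<alpha> + \<beta>) x + L / b ^ n * (x * gamma_density (R n l) (\<alpha> + \<beta>) x))"
        by (rule ennreal_leI)
      also have "\<dots> = ennreal (D * gamma_density (R n l) (\<alpha> + \<beta>) x)
          + ennreal (L / b ^ n * (x * gamma_density (R n l) (\<alpha> + \<beta>) x))"
        using D g True by (intro ennreal_plus mult_nonneg_nonneg) auto
      also have "\<dots> = ennreal D * ennreal (gamma_density (R n l) (\<alpha> + \<beta>) x)
            + ennreal (L / b ^ n) * ennreal (x * gamma_density (R n l) (\<alpha> + \<beta>) x)"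
        using D by (simp only: ennreal_mult')
      finally show ?thesis .
    qed (simp add: gamma_density_nonpos)
  qed
  also have "\<dots> = ennreal D + ennreal (L / b ^ n) * ennreal ((\<alpha> + \<beta>) / R n l)"
    by (simp add: nn_integral_add nn_integral_cmult nn_integral_gamma_density nn_integral_gamma_density_mean q_pos R_pos)
  also have "\<dots> = ennreal (D + L / b ^ n * ((\<alpha> + \<beta>) / R n l))"
  proof -
    have "0 \<le> L / b ^ n * ((\<alpha> + \<beta>) / R n l)"
      using q_pos R_pos[of n l] by (intro mult_nonneg_nonneg[OF D(2)] divide_nonneg_pos) auto
    then show ?thesis using D by (simp only: ennreal_plus ennreal_mult')
  qed
  also have "\<dots> \<le> ennreal (D + L / b ^ n * ((\<alpha> + \<beta>) / Rmin n))"
    using D q_pos R_pos[of n l] Rmin_pos[of n] Rmin_le[of n l]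
    by (intro ennreal_leI add_left_mono mult_left_mono divide_left_mono mult_pos_pos) auto
  finally show "(\<integral>\<^sup>+x. ennreal (gamma_density (R n l) (\<alpha> + \<beta>) x * T n l x) \<partial>lborel)
      \<le> ennreal (\<bar>h 0\<bar> + real n * (L * \<beta> / u) + L / b ^ n * ((\<alpha> + \<beta>) / Rmin n))"
    by (simp add: D_def)
qed

lemma nn_integral_mix:
  assumes [measurable]: "A \<in> sets borel"
  shows "(\<integral>\<^sup>+x. mix n x * indicator A x \<partial>lborel)
    = (\<integral>\<^sup>+l. ennreal (W n l) * (\<integral>\<^sup>+x. ennreal (indicator A x * (gamma_density (R n l) (\<alpha> + \<beta>) x * T n l x)) \<partial>lborel) \<partial>U)"
proof -
  interpret pair_sigma_finite U lborel ..
  have "(\<integral>\<^sup>+x. mix n x * indicator A x \<partial>lborel)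
      = (\<integral>\<^sup>+x. \<integral>\<^sup>+l. ennreal (kernel n l x) * indicator A x \<partial>U \<partial>lborel)"
    unfolding mix_def by (intro nn_integral_cong nn_integral_multc[symmetric]) measurable
  also have "\<dots> = (\<integral>\<^sup>+l. \<integral>\<^sup>+x. ennreal (kernel n l x) * indicator A x \<partial>lborel \<partial>U)"
    by (intro Fubini') measurable
  also have "\<dots> = (\<integral>\<^sup>+l. ennreal (W n l) * (\<integral>\<^sup>+x. ennreal (indicator A x * (gamma_density (R n l) (\<alpha> + \<beta>) x * T n l x)) \<partial>lborel) \<partial>U)"
  proof (rule nn_integral_cong)
    fix l assume [measurable]: "l \<in> space U"
    have "(\<integral>\<^sup>+x. ennreal (kernel n l x) * indicator A x \<partial>lborel)
      = (\<integral>\<^sup>+x. ennreal (W n l) * ennreal (indicator A x * (gamma_density (R n l) (\<alpha> + \<beta>) x * T n l x)) \<partial>lborel)"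
      using W_pos[of n l]
      by (intro nn_integral_cong) (auto simp: kernel_def ennreal_mult' split: split_indicator)
    also have "\<dots> = ennreal (W n l) * (\<integral>\<^sup>+x. ennreal (indicator A x * (gamma_density (R n l) (\<alpha> + \<beta>) x * T n l x)) \<partial>lborel)"
      by (intro nn_integral_cmult) measurable
    finally show "(\<integral>\<^sup>+x. ennreal (kernel n l x) * indicator A x \<partial>lborel)
      = ennreal (W n l) * (\<integral>\<^sup>+x. ennreal (indicator A x * (gamma_density (R n l) (\<alpha> + \<beta>) x * T n l x)) \<partial>lborel)" .
  qed
  finally show ?thesis .
qed

lemma mass_eq:
  "mass n = (\<integral>\<^sup>+l. ennreal (W n l) * (\<integral>\<^sup>+x. ennreal (gamma_density (R n l) (\<alpha> + \<beta>) x * T n l x) \<partial>lborel) \<partial>U)"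
  using nn_integral_mix[of UNIV n] by (simp add: mass_def)

lemma mass_finite: "mass n < \<infinity>"
proof -
  obtain K where K: "\<And>l. W n l \<le> K" using W_bounded by blast
  define E where "E = \<bar>h 0\<bar> + real n * (L * \<beta> / u) + L / b ^ n * ((\<alpha> + \<beta>) / Rmin n)"
  have "mass n \<le> (\<integral>\<^sup>+l. ennreal K * ennreal E \<partial>U)"
    unfolding mass_eq E_def using nn_integral_gamma_T_bounds(2) K
    by (intro nn_integral_mono mult_mono ennreal_leI) auto
  also have "\<dots> < \<infinity>" by (simp add: emeasure_space_1 ennreal_mult_less_top)
  finally show ?thesis .
qed

lemma mass_pos: "0 < mass n"
proof -
  have "mass n \<noteq> 0"
  proof
    assume "mass n = 0"
    moreover have "(\<integral>\<^sup>+l. ennreal (W n l) * ennreal H \<partial>U) \<le> mass n"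
      unfolding mass_eq using nn_integral_gamma_T_bounds(1)
      by (intro nn_integral_mono mult_left_mono) auto
    ultimately have "(\<integral>\<^sup>+l. ennreal (W n l) * ennreal H \<partial>U) = 0" by simp
    then have "AE l in U. ennreal (W n l) * ennreal H = 0"
      by (subst (asm) nn_integral_0_iff_AE) auto
    then have "AE l in U. False"
    proof (rule AE_mp, intro AE_I2 impI)
      fix l assume "ennreal (W n l) * ennreal H = 0"
      then show False using W_pos[of n l] H by (auto simp: ennreal_eq_0_iff)
    qed
    then show False by simp
  qed
  then show ?thesis by (simp add: zero_less_iff_neq_zero)
qed

section \<open>One filter step on the unnormalized mixture\<close>

lemma nn_integral_shift_T:
  "(\<integral>\<^sup>+s. ennreal (gamma_density (R n l) \<beta> (s - x / b) * T n l s) \<partial>lborel) = ennreal (T (Suc n) l x)"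
proof -
  have "(\<integral>\<^sup>+s. ennreal (gamma_density (R n l) \<beta> (s - x / b) * T n l s) \<partial>lborel)
     = ennreal \<bar>1\<bar> * (\<integral>\<^sup>+t. ennreal (gamma_density (R n l) \<beta> ((x / b + 1 * t) - x / b) * T n l (x / b + 1 * t)) \<partial>lborel)"
    by (intro nn_integral_real_affine measurable_compose[OF _ measurable_ennreal] borel_measurable_times
         measurable_gamma_density measurable_tilt) auto
  also have "\<dots> = (\<integral>\<^sup>+t. ennreal (gamma_density (R n l) \<beta> t * T n l (x / b + t)) \<partial>lborel)"
    by simp
  also have "\<dots> = ennreal (T (Suc n) l x)"
    unfolding tilt.simps
    using T_pos \<beta> by (intro nn_integral_eq_integral T_integrable AE_I2 mult_nonneg_nonneg gamma_density_nonneg)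
      (auto intro: less_imp_le)
  finally show ?thesis .
qed

text \<open>Conjugacy lets a filter step act on each component separately: the constant goes into
  the weight, the density in \<open>x\<close> gets the new rate, and the density in
  \<open>s - x / b\<close> integrates the old tilt to the new one.\<close>

lemma kernel_step:
  assumes x: "x > 0"
  shows "(\<integral>\<^sup>+s. ennreal (obs_density \<beta> x (y (Suc n)) * (transition_density \<alpha> \<beta> b s x * kernel n l s)) \<partial>lborel)
     = ennreal (kernel (Suc n) l x)"
proof -
  define w where "w = (R n l / b) powr \<alpha> * y (Suc n) powr (\<beta> - 1)
          / (Beta \<alpha> \<beta> * R (Suc n) l powr (\<alpha> + \<beta>))"
  have w: "W (Suc n) l = W n l * w" by (simp add: w_def)
  define g where "g = W (Suc n) l * gamma_density (R (Suc n) l) (\<alpha> + \<beta>) x"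
  have g: "0 \<le> g" unfolding g_def using W_pos[of "Suc n" l] q_pos
    by (intro mult_nonneg_nonneg gamma_density_nonneg) auto
  have "obs_density \<beta> x (y (Suc n)) * (transition_density \<alpha> \<beta> b s x * kernel n l s)
     = g * (gamma_density (R n l) \<beta> (s - x / b) * T n l s)" for s
  proof -
    have "obs_density \<beta> x (y (Suc n)) * (transition_density \<alpha> \<beta> b s x * kernel n l s)
      = W n l * T n l s * (obs_density \<beta> x (y (Suc n)) * (transition_density \<alpha> \<beta> b s x * gamma_density (R n l) (\<alpha> + \<beta>) s))"
      by (simp only: kernel_def mult_ac)
    also have "\<dots> = W n l * T n l s * (w * gamma_density (R (Suc n) l) (\<alpha> + \<beta>) x * gamma_density (R n l) \<beta> (s - x / b))"
      using filter_kernel_gamma_density[OF \<alpha> \<beta> b R_pos _ x, of "y (Suc n)" s n l] y[of "Suc n"]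
      by (simp add: w_def)
    also have "\<dots> = g * (gamma_density (R n l) \<beta> (s - x / b) * T n l s)"
      unfolding g_def w by (simp only: mult_ac)
    finally show ?thesis .
  qed
  then have "(\<integral>\<^sup>+s. ennreal (obs_density \<beta> x (y (Suc n)) * (transition_density \<alpha> \<beta> b s x * kernel n l s)) \<partial>lborel)
     = (\<integral>\<^sup>+s. ennreal g * ennreal (gamma_density (R n l) \<beta> (s - x / b) * T n l s) \<partial>lborel)"
    using g by (simp add: ennreal_mult')
  also have "\<dots> = ennreal g * (\<integral>\<^sup>+s. ennreal (gamma_density (R n l) \<beta> (s - x / b) * T n l s) \<partial>lborel)"
    by (intro nn_integral_cmult measurable_compose[OF _ measurable_ennreal] borel_measurable_times
         measurable_gamma_density measurable_tilt) auto
  also have "\<dots> = ennreal (g * T (Suc n) l x)"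
    unfolding nn_integral_shift_T using g by (simp add: ennreal_mult' del: tilt.simps)
  finally show ?thesis by (simp add: g_def kernel_def mult_ac del: tilt.simps)
qed

lemma measurable_transition_density [measurable (raw)]:
  assumes [measurable]: "f \<in> borel_measurable N"
  shows "(\<lambda>s. transition_density \<alpha> \<beta> b (f s) x) \<in> borel_measurable N"
proof -
  have "transition_density \<alpha> \<beta> b s x = (b * s) powr (1 - (\<alpha> + \<beta>)) / Beta \<alpha> \<beta> * x powr (\<alpha> - 1) * (b * s - x) powr (\<beta> - 1)
       * (if 0 \<le> x \<and> x \<le> b * s then 1 else 0)" for s
    by (simp add: transition_density_def indicator_def)
  then show ?thesis by simp
qed

lemma obs_density_nonneg: "0 \<le> obs_density \<beta> x z"
  unfolding obs_density_def using \<beta>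
  by (auto intro!: mult_nonneg_nonneg divide_nonneg_nonneg Gamma_real_nonneg)

lemma transition_density_nonneg: "0 \<le> transition_density \<alpha> \<beta> b s x"
  unfolding transition_density_def using \<alpha> \<beta>
  by (auto intro!: mult_nonneg_nonneg divide_nonneg_nonneg simp: Beta_def Gamma_real_nonneg)

text \<open>The step is linear in the density, so by Tonelli it may be carried out inside the
  mixture. The factor \<open>C\<close> stands for the normalization reached so far.\<close>

lemma unnormalized_step:
  assumes x: "x > 0" and C: "0 \<le> C" and f: "\<And>s. s > 0 \<Longrightarrow> f s = C * enn2real (mix n s)"
  shows "obs_density \<beta> x (y (Suc n)) * (LINT s:{0<..}|lborel. transition_density \<alpha> \<beta> b s x * f s)
     = C * enn2real (mix (Suc n) x)"
proof -
  interpret pair_sigma_finite U lborel ..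
  let ?o = "obs_density \<beta> x (y (Suc n))" and ?p = "\<lambda>s. transition_density \<alpha> \<beta> b s x"
  have "(LINT s:{0<..}|lborel. ?p s * f s) = (LINT s|lborel. ?p s * (C * enn2real (mix n s)))"
    unfolding set_lebesgue_integral_def
    by (intro Bochner_Integration.integral_cong) (auto simp: f mix_nonpos split: split_indicator)
  then have "?o * (LINT s:{0<..}|lborel. ?p s * f s)
      = C * (LINT s|lborel. ?o * (?p s * enn2real (mix n s)))"
    by (simp add: mult_ac)
  also have "(LINT s|lborel. ?o * (?p s * enn2real (mix n s)))
      = enn2real (\<integral>\<^sup>+s. ennreal (?o * (?p s * enn2real (mix n s))) \<partial>lborel)"
    by (intro integral_eq_nn_integral AE_I2 mult_nonneg_nonneg obs_density_nonneg transition_density_nonneg) auto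
  also have "(\<integral>\<^sup>+s. ennreal (?o * (?p s * enn2real (mix n s))) \<partial>lborel)
     = (\<integral>\<^sup>+s. (\<integral>\<^sup>+l. ennreal (?o * (?p s * kernel n l s)) \<partial>U) \<partial>lborel)"
  proof (rule nn_integral_cong)
    fix s :: real
    have op: "0 \<le> ?o * ?p s" by (intro mult_nonneg_nonneg obs_density_nonneg transition_density_nonneg)
    have "ennreal (?o * (?p s * enn2real (mix n s))) = ennreal (?o * ?p s) * mix n s"
      using op mix_finite[of n s] by (simp add: ennreal_mult' mult.assoc[symmetric])
    also have "\<dots> = (\<integral>\<^sup>+l. ennreal (?o * ?p s) * ennreal (kernel n l s) \<partial>U)"
      unfolding mix_def by (intro nn_integral_cmult[symmetric]) measurable
    also have "\<dots> = (\<integral>\<^sup>+l. ennreal (?o * (?p s * kernel n l s)) \<partial>U)"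
      using op by (simp add: ennreal_mult'[symmetric] mult.assoc)
    finally show "ennreal (?o * (?p s * enn2real (mix n s))) = (\<integral>\<^sup>+l. ennreal (?o * (?p s * kernel n l s)) \<partial>U)" .
  qed
  also have "\<dots> = (\<integral>\<^sup>+l. (\<integral>\<^sup>+s. ennreal (?o * (?p s * kernel n l s)) \<partial>lborel) \<partial>U)"
    by (intro Fubini') measurable
  also have "\<dots> = mix (Suc n) x"
    unfolding mix_def using kernel_step[OF x] by simp
  finally show ?thesis .
qed

lemma integral_mix: "(LINT z:{0<..}|lborel. C * enn2real (mix n z)) = C * enn2real (mass n)"
proof -
  have "(LINT z:{0<..}|lborel. C * enn2real (mix n z)) = (LINT z|lborel. C * enn2real (mix n z))"
    unfolding set_lebesgue_integral_def
    by (intro Bochner_Integration.integral_cong) (auto simp: mix_nonpos split: split_indicator)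
  also have "\<dots> = C * enn2real (\<integral>\<^sup>+z. ennreal (enn2real (mix n z)) \<partial>lborel)"
    by (simp add: integral_eq_nn_integral)
  also have "\<dots> = C * enn2real (mass n)"
    using mix_finite by (simp add: mass_def)
  finally show ?thesis .
qed

text \<open>The normalization of time \<open>n\<close> appears in numerator and denominator of the
  next step and cancels, which leaves the mixture divided by its own mass. At time \<open>0\<close>
  the constant \<open>C\<close> is determined by \<open>f\<close> having integral
  \<open>1\<close>.\<close>

lemma opt_filter_eq_mix:
  assumes f0: "\<And>x. x > 0 \<Longrightarrow> f x = C * enn2real (mix 0 x)" and f: "prob_density_pos f" and x: "x > 0"
  shows "opt_filter \<alpha> \<beta> b f y n x = enn2real (mix n x) / enn2real (mass n)"
  using x
proof (induction n arbitrary: x)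
  case 0
  have "(LINT x:{0<..}|lborel. f x) = (LINT x:{0<..}|lborel. C * enn2real (mix 0 x))"
    by (intro set_lebesgue_integral_cong) (auto simp: f0)
  then have "C * enn2real (mass 0) = 1"
    using f integral_mix[of C 0] by (simp add: prob_density_pos_def)
  then have "C = 1 / enn2real (mass 0)" by (metis mult_zero_right zero_neq_one nonzero_eq_divide_eq)
  then show ?case using f0[OF 0] by simp
next
  case (Suc n)
  define C' where "C' = 1 / enn2real (mass n)"
  have mp: "0 < enn2real (mass n)" for n
    using mass_pos[of n] mass_finite[of n] by (simp add: enn2real_positive_iff)
  then have C': "0 < C'" unfolding C'_def by simp
  define N where "N x = obs_density \<beta> x (y (Suc n))
      * (LINT s:{0<..}|lborel. transition_density \<alpha> \<beta> b s x * opt_filter \<alpha> \<beta> b f y n s)" for x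
  have N: "N x = C' * enn2real (mix (Suc n) x)" if "x > 0" for x
    unfolding N_def using C' that by (intro unnormalized_step) (auto simp: Suc.IH C'_def)
  have "(LINT z:{0<..}|lborel. N z) = (LINT z:{0<..}|lborel. C' * enn2real (mix (Suc n) z))"
    by (intro set_lebesgue_integral_cong) (auto simp: N)
  then have "(LINT z:{0<..}|lborel. N z) = C' * enn2real (mass (Suc n))"
    by (simp only: integral_mix)
  moreover have "opt_filter \<alpha> \<beta> b f y (Suc n) x = N x / (LINT z:{0<..}|lborel. N z)"
    by (simp add: N_def)
  ultimately show ?case using C' N[OF Suc.prems] by simp
qed

section \<open>Total variation distance of two filters\<close>

text \<open>A real integral, in contrast to \<open>mix\<close>, since contributions of different
  sets are subtracted below.\<close>

definition part :: "nat \<Rightarrow> real set \<Rightarrow> 'b \<Rightarrow> real" where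
  "part n A l = (LINT x|lborel. indicator A x * (gamma_density (R n l) (\<alpha> + \<beta>) x * T n l x))"

lemma gamma_T_integrable: "integrable lborel (\<lambda>x. gamma_density (R n l) (\<alpha> + \<beta>) x * T n l x)"
  using gamma_density_lipschitz_integrable[OF T_lipschitz q_pos R_pos, of n l n l 0] by simp

lemma part_integrable:
  "A \<in> sets borel \<Longrightarrow> integrable lborel (\<lambda>x. indicator A x * (gamma_density (R n l) (\<alpha> + \<beta>) x * T n l x))"
  using integrable_real_mult_indicator[OF _ gamma_T_integrable, of A n l] by (simp add: mult.commute)

lemma gamma_T_nonneg: "0 \<le> gamma_density (R n l) (\<alpha> + \<beta>) x * T n l x"
  using T_pos q_pos by (intro mult_nonneg_nonneg gamma_density_nonneg) (auto intro: less_imp_le)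

lemma part_nonneg: "0 \<le> part n A l"
  unfolding part_def by (intro integral_nonneg_AE AE_I2 mult_nonneg_nonneg gamma_T_nonneg) auto

lemma measurable_part [measurable]:
  assumes [measurable]: "A \<in> sets borel"
  shows "part n A \<in> borel_measurable U"
  unfolding part_def by measurable

lemma part_UNIV_ge: "H \<le> part n UNIV l"
  using gamma_density_lipschitz_lower[OF T_lipschitz[of n l] q_pos R_pos[of n l] T_ge[of n l], of 0]
  by (simp add: part_def)

lemma nn_integral_mix_part:
  assumes A: "A \<in> sets borel"
  shows "(\<integral>\<^sup>+x. mix n x * indicator A x \<partial>lborel) = (\<integral>\<^sup>+l. ennreal (W n l * part n A l) \<partial>U)"
  unfolding nn_integral_mix[OF A]
proof (rule nn_integral_cong)
  fix l
  have "(\<integral>\<^sup>+x. ennreal (indicator A x * (gamma_density (R n l) (\<alpha> + \<beta>) x * T n l x)) \<partial>lborel) = ennreal (part n A l)"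
    unfolding part_def
    by (intro nn_integral_eq_integral part_integrable A AE_I2 mult_nonneg_nonneg gamma_T_nonneg) auto
  then show "ennreal (W n l) * (\<integral>\<^sup>+x. ennreal (indicator A x * (gamma_density (R n l) (\<alpha> + \<beta>) x * T n l x)) \<partial>lborel)
     = ennreal (W n l * part n A l)"
    using W_pos[of n l] by (simp add: ennreal_mult')
qed

lemma W_part:
  assumes A: "A \<in> sets borel"
  shows W_part_integrable: "integrable U (\<lambda>l. W n l * part n A l)"
    and W_part_integral: "(LINT l|U. W n l * part n A l) = enn2real (\<integral>\<^sup>+x. mix n x * indicator A x \<partial>lborel)"
proof -
  have nn: "0 \<le> W n l * part n A l" for l
    using W_pos part_nonneg by (intro mult_nonneg_nonneg) (auto intro: less_imp_le)
  have "(\<integral>\<^sup>+x. mix n x * indicator A x \<partial>lborel) \<le> mass n"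
    unfolding mass_def by (intro nn_integral_mono) (auto split: split_indicator)
  also have "\<dots> < \<infinity>" by (rule mass_finite)
  finally show "integrable U (\<lambda>l. W n l * part n A l)"
    using nn A by (intro integrableI_nonneg) (auto simp: nn_integral_mix_part)
  show "(LINT l|U. W n l * part n A l) = enn2real (\<integral>\<^sup>+x. mix n x * indicator A x \<partial>lborel)"
    using nn A by (simp add: nn_integral_mix_part integral_eq_nn_integral)
qed

lemma W_integrable: "integrable U (\<lambda>l. W n l)"
proof -
  obtain K where K: "\<And>l. W n l \<le> K" using W_bounded by blast
  show ?thesis
    by (intro integrable_const_bound[where B = K])
      (use K W_pos in \<open>auto simp: less_imp_le abs_of_pos\<close>)
qed

lemma W_integral_pos: "0 < (LINT l|U. W n l)"
proof -
  have "(LINT l|U. W n l) \<noteq> 0"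
  proof
    assume "(LINT l|U. W n l) = 0"
    then have "AE l in U. W n l = 0"
      using integral_nonneg_eq_0_iff_AE[OF W_integrable[of n]] W_pos by (auto intro: less_imp_le)
    then have "AE l in U. False" by (rule AE_mp) (use W_pos in \<open>auto intro!: AE_I2 simp: less_imp_neq[symmetric]\<close>)
    then show False by simp
  qed
  moreover have "0 \<le> (LINT l|U. W n l)"
    using W_pos by (intro Bochner_Integration.integral_nonneg) (auto intro: less_imp_le)
  ultimately show ?thesis by simp
qed

lemma
  assumes f0: "\<And>x. x > 0 \<Longrightarrow> f x = C * enn2real (mix 0 x)" and f: "prob_density_pos f"
  shows measure_opt_filter: "A \<in> sets borel \<Longrightarrow> measure (measure_pos (opt_filter \<alpha> \<beta> b f y n)) A
      = (LINT l|U. W n l * part n A l) / (LINT l|U. W n l * part n UNIV l)"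
    and prob_space_opt_filter: "prob_space (measure_pos (opt_filter \<alpha> \<beta> b f y n))"
proof -
  define m where "m = enn2real (mass n)"
  have m: "0 < m" unfolding m_def
    using mass_pos[of n] mass_finite[of n] by (simp add: enn2real_positive_iff)
  have dens: "indicator {0<..} x * opt_filter \<alpha> \<beta> b f y n x = enn2real (mix n x) / m" for x
    using opt_filter_eq_mix[OF f0 f, of x n] by (auto simp: mix_nonpos m_def split: split_indicator)
  have em: "emeasure (measure_pos (opt_filter \<alpha> \<beta> b f y n)) A
      = ennreal (1 / m) * (\<integral>\<^sup>+x. mix n x * indicator A x \<partial>lborel)" if [measurable]: "A \<in> sets borel" for A
  proof -
    have "emeasure (measure_pos (opt_filter \<alpha> \<beta> b f y n)) A
       = (\<integral>\<^sup>+x. ennreal (enn2real (mix n x) / m) * indicator A x \<partial>lborel)"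
      unfolding measure_pos_def dens by (subst emeasure_density) auto
    also have "\<dots> = (\<integral>\<^sup>+x. ennreal (1 / m) * (mix n x * indicator A x) \<partial>lborel)"
    proof (rule nn_integral_cong)
      fix x
      have "ennreal (enn2real (mix n x) / m) = ennreal (1 / m * enn2real (mix n x))" by simp
      also have "\<dots> = ennreal (1 / m) * mix n x"
        using m mix_finite[of n x] by (subst ennreal_mult') auto
      finally show "ennreal (enn2real (mix n x) / m) * indicator A x = ennreal (1 / m) * (mix n x * indicator A x)"
        by (simp add: mult.assoc)
    qed
    also have "\<dots> = ennreal (1 / m) * (\<integral>\<^sup>+x. mix n x * indicator A x \<partial>lborel)"
      by (intro nn_integral_cmult) measurable
    finally show ?thesis .
  qed
  have mU: "(LINT l|U. W n l * part n UNIV l) = m"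
    by (simp add: W_part_integral m_def mass_def)
  show "measure (measure_pos (opt_filter \<alpha> \<beta> b f y n)) A
      = (LINT l|U. W n l * part n A l) / (LINT l|U. W n l * part n UNIV l)" if A: "A \<in> sets borel"
    unfolding mU measure_def em[OF A] W_part_integral[OF A] using m by (simp add: enn2real_mult)
  show "prob_space (measure_pos (opt_filter \<alpha> \<beta> b f y n))"
  proof
    have "emeasure (measure_pos (opt_filter \<alpha> \<beta> b f y n)) UNIV = ennreal (1 / m) * mass n"
      by (simp add: em mass_def)
    also have "\<dots> = ennreal (1 / m) * ennreal m"
      using mass_finite[of n] by (simp add: m_def)
    also have "\<dots> = 1" using m by (simp flip: ennreal_mult')
    finally show "emeasure (measure_pos (opt_filter \<alpha> \<beta> b f y n)) (space (measure_pos (opt_filter \<alpha> \<beta> b f y n))) = 1"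
      by (simp add: measure_pos_def)
  qed
qed

lemma tilt_const: "tilt \<beta> b y (\<lambda>_. 1) n (lam l) x = 1"
proof (induction n arbitrary: x)
  case (Suc n)
  then show ?case using gamma_density_integrable[OF \<beta> R_pos] by simp
qed simp

text \<open>This makes the untilted filter another instance with the same \<open>lam\<close> and
  \<open>y\<close>, hence with the same rates and weights; by \<open>tilt_const\<close> only the
  tilt differs.\<close>

lemma gamma_mixture_const: "gamma_mixture U lam u v \<alpha> \<beta> b 0 1 y (\<lambda>_. 1)"
proof
  show "0-lipschitz_on UNIV (\<lambda>_::real. 1::real)" by (intro lipschitz_onI) auto
qed (use lam_ge lam_le u \<alpha> \<beta> b y in auto)

text \<open>
  Every component dominates \<open>(Rmin n / Rmax n) powr (\<alpha> + \<beta>)\<close> times the component of rate \<open>Rmax n\<close>, so the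
  probabilities of a set under the components differ at most by the remaining mass.
\<close>

lemma gamma_part_oscillation:
  fixes S :: "'b \<Rightarrow> real" and n A
  defines "S \<equiv> (\<lambda>l. LINT x|lborel. indicator A x * gamma_density (R n l) (\<alpha> + \<beta>) x)"
  assumes A: "A \<in> sets borel"
  shows "\<exists>c. \<forall>l. c \<le> S l \<and> S l \<le> c + (1 - (Rmin n / Rmax n) powr (\<alpha> + \<beta>))"
proof (intro exI allI conjI)
  fix l
  define r where "r = (Rmin n / Rmax n) powr (\<alpha> + \<beta>)"
  have vp: "0 < Rmax n" using R_pos[of n l] Rmax_ge[of n l] by linarith
  define g where "g x = gamma_density (R n l) (\<alpha> + \<beta>) x - r * gamma_density (Rmax n) (\<alpha> + \<beta>) x" for x
  have g0: "0 \<le> g x" for x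
    unfolding g_def r_def using gamma_density_ratio_lower[OF Rmin_pos[of n] Rmin_le[of n l] Rmax_ge[of n l] q_pos, of x]
    by simp
  note i1 = gamma_density_integrable[OF q_pos R_pos, of n l] and i2 = gamma_density_integrable[OF q_pos vp]
  have gi: "integrable lborel g" unfolding g_def using i1 i2 by simp
  have gI: "(LINT x|lborel. g x) = 1 - r" unfolding g_def using i1 i2 by simp
  have ind: "integrable lborel (\<lambda>x. indicator A x * k x)" if "integrable lborel k" for k :: "real \<Rightarrow> real"
    using integrable_real_mult_indicator[OF _ that, of A] A by (simp add: mult.commute)
  have "S l = (LINT x|lborel. indicator A x * (r * gamma_density (Rmax n) (\<alpha> + \<beta>) x + g x))"
    unfolding S_def by (simp add: g_def)
  also have "\<dots> = r * (LINT x|lborel. indicator A x * gamma_density (Rmax n) (\<alpha> + \<beta>) x) + (LINT x|lborel. indicator A x * g x)"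
    using ind[OF i2(1)] ind[OF gi] by (simp add: distrib_left mult.left_commute[of _ r])
  finally have S: "S l = r * (LINT x|lborel. indicator A x * gamma_density (Rmax n) (\<alpha> + \<beta>) x) + (LINT x|lborel. indicator A x * g x)" .
  have "0 \<le> (LINT x|lborel. indicator A x * g x)"
    using g0 by (intro integral_nonneg_AE AE_I2 mult_nonneg_nonneg) auto
  then show "r * (LINT x|lborel. indicator A x * gamma_density (Rmax n) (\<alpha> + \<beta>) x) \<le> S l"
    unfolding S by simp
  have "(LINT x|lborel. indicator A x * g x) \<le> (LINT x|lborel. g x)"
    using ind[OF gi] gi g0 by (intro integral_mono) (auto split: split_indicator)
  then show "S l \<le> r * (LINT x|lborel. indicator A x * gamma_density (Rmax n) (\<alpha> + \<beta>) x) + (1 - r)"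
    unfolding S gI by simp
qed

text \<open>Replacing the tilt by the constant \<open>h 0\<close> would make both filters equal, so
  only the deviation from it matters. The deviation of \<open>T n l x\<close> from
  \<open>T n l 0\<close> costs the Lipschitz constant times the mean of the component. The deviation
  of \<open>T n l 0\<close> from \<open>h 0\<close> grows with \<open>n\<close>, but it depends on
  \<open>l\<close> alone and is therefore multiplied by the oscillation of the component
  probabilities. Dividing by the total mass costs \<open>1 / H\<close>.\<close>

lemma tv_dist_opt_filter_le:
  assumes f0: "\<And>x. x > 0 \<Longrightarrow> f x = C * enn2real (mix 0 x)" and f: "prob_density_pos f"
    and g0: "\<And>x. x > 0 \<Longrightarrow> g x = C' * enn2real (gamma_mixture.mix U lam \<alpha> \<beta> b y (\<lambda>_. 1) 0 x)"
    and g: "prob_density_pos g"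
  shows "tv_dist (measure_pos (opt_filter \<alpha> \<beta> b g y n)) (measure_pos (opt_filter \<alpha> \<beta> b f y n))
     \<le> (L / b ^ n * ((\<alpha> + \<beta>) / Rmin n)
         + real n * (L * \<beta> / u) * (1 - (Rmin n / Rmax n) powr (\<alpha> + \<beta>))) / H"
proof -
  interpret one: gamma_mixture U lam u v \<alpha> \<beta> b 0 1 y "\<lambda>_. 1" by (rule gamma_mixture_const)
  define r where "r = 1 - (Rmin n / Rmax n) powr (\<alpha> + \<beta>)"
  define E where "E = L / b ^ n * ((\<alpha> + \<beta>) / Rmin n) + real n * (L * \<beta> / u) * r"
  define m where "m = (LINT l|U. W n l)"
  have m: "0 < m" unfolding m_def by (rule W_integral_pos)
  have one_UNIV: "one.part n UNIV l = 1" for l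
    using gamma_density_integrable[OF q_pos R_pos] by (simp add: one.part_def tilt_const)
  define J where "J A = (LINT l|U. W n l * part n A l)" for A
  have JU: "H * m \<le> J UNIV"
  proof -
    have "H * m = (LINT l|U. W n l * H)" by (simp add: m_def mult.commute)
    also have "\<dots> \<le> J UNIV" unfolding J_def
      using W_part_integrable[of UNIV n] W_integrable[of n] W_pos part_UNIV_ge
      by (intro integral_mono mult_left_mono) (auto intro: less_imp_le)
    finally show ?thesis .
  qed
  have "\<bar>measure (measure_pos (opt_filter \<alpha> \<beta> b g y n)) A - measure (measure_pos (opt_filter \<alpha> \<beta> b f y n)) A\<bar> \<le> E / H"
    if A: "A \<in> sets borel" for A
  proof -
    define S where "S l = (LINT x|lborel. indicator A x * gamma_density (R n l) (\<alpha> + \<beta>) x)" for l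
    have S1: "one.part n A l = S l" for l by (simp add: one.part_def tilt_const S_def)
    define mu where "mu = (LINT l|U. W n l * S l) / m"
    have mu: "measure (measure_pos (opt_filter \<alpha> \<beta> b g y n)) A = mu"
      using one.measure_opt_filter[OF g0 g A, of n] by (simp add: one_UNIV S1 mu_def m_def)
    have mu01: "0 \<le> mu" "mu \<le> 1"
      using mu measure_nonneg[of "measure_pos (opt_filter \<alpha> \<beta> b g y n)" A]
        prob_space.prob_le_1[OF one.prob_space_opt_filter[OF g0 g, of n], of A] by auto
    have WS: "integrable U (\<lambda>l. W n l * S l)"
      using one.W_part_integrable[OF A, of n] by (simp add: S1)
    have mS: "mu * m = (LINT l|U. W n l * S l)" using m by (simp add: mu_def)
    obtain c where c: "\<And>l. c \<le> S l" "\<And>l. S l \<le> c + r"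
      using gamma_part_oscillation[OF A, of n] unfolding S_def r_def by blast
    \<comment> \<open>\<open>mu\<close> is a weighted mean of the values of \<open>S\<close> and
      lies in the same interval of length \<open>r\<close>.\<close>
    have "c \<le> mu" "mu \<le> c + r"
    proof -
      have "m * c = (LINT l|U. W n l * c)" by (simp add: m_def)
      also have "\<dots> \<le> mu * m" unfolding mS
        using WS W_integrable[of n] c W_pos by (intro integral_mono mult_left_mono) (auto intro: less_imp_le)
      finally show "c \<le> mu" using m by simp
      have "mu * m \<le> (LINT l|U. W n l * (c + r))" unfolding mS
        using WS W_integrable[of n] c W_pos by (intro integral_mono mult_left_mono) (auto intro: less_imp_le)
      also have "\<dots> = (c + r) * m" by (simp add: m_def mult.commute)
      finally show "mu \<le> c + r" using m by simp
    qed
    then have osc: "\<bar>S l - mu\<bar> \<le> r" for l using c[of l] by linarith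
    \<comment> \<open>Up to normalization the difference of the two measures of \<open>A\<close> is the weighted average of
      \<open>\<integral> gamma * (T - h 0) * (indicator A - mu)\<close>; split \<open>T x - h 0\<close> at \<open>T 0\<close>.\<close>
    have G: "\<bar>part n A l - mu * part n UNIV l - h 0 * (S l - mu)\<bar> \<le> E" for l
    proof -
      let ?g = "gamma_density (R n l) (\<alpha> + \<beta>)"
      define d where "d x = (indicator A x - mu) * (?g x * (T n l x - T n l 0))" for x
      note gi = gamma_density_integrable[OF q_pos R_pos, of n l]
      note gm = gamma_density_mean_integrable[OF q_pos R_pos, of n l]
      have gA: "integrable lborel (\<lambda>x. indicator A x * ?g x)"
        using integrable_real_mult_indicator[OF _ gi(1), of A] A by (simp add: mult.commute)
      note pA = part_integrable[OF A, of n l] and pU = gamma_T_integrable[of n l]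
      have d_eq: "d x = indicator A x * (?g x * T n l x) - mu * (?g x * T n l x)
          - T n l 0 * (indicator A x * ?g x) + T n l 0 * mu * ?g x" for x
        by (simp add: d_def algebra_simps)
      have di: "integrable lborel d" unfolding d_eq using gA pA pU gi by simp
      have "(LINT x|lborel. d x) = part n A l - mu * part n UNIV l - T n l 0 * S l + T n l 0 * mu"
        unfolding d_eq using gA pA pU gi by (simp add: part_def S_def)
      then have split: "part n A l - mu * part n UNIV l - h 0 * (S l - mu)
          = (LINT x|lborel. d x) + (T n l 0 - h 0) * (S l - mu)" by (simp add: algebra_simps)
      have "\<bar>LINT x|lborel. d x\<bar> \<le> (LINT x|lborel. L / b ^ n * (x * ?g x))"
      proof (intro order_trans[OF integral_abs_bound] integral_mono)
        show "integrable lborel (\<lambda>x. \<bar>d x\<bar>)" using di by simp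
        show "integrable lborel (\<lambda>x. L / b ^ n * (x * ?g x))" using gm by simp
        fix x :: real
        show "\<bar>d x\<bar> \<le> L / b ^ n * (x * ?g x)"
        proof (cases "x > 0")
          case True
          have g0: "0 \<le> ?g x" using q_pos by (rule gamma_density_nonneg)
          have "\<bar>d x\<bar> = \<bar>indicator A x - mu\<bar> * (?g x * \<bar>T n l x - T n l 0\<bar>)"
            using g0 by (simp add: d_def abs_mult)
          also have "\<dots> \<le> 1 * (?g x * (L / b ^ n * x))"
            using mu01 g0 lipschitz_on_UNIV_abs_diff_le[OF T_lipschitz, of n l x 0] True
            by (intro mult_mono mult_left_mono) (auto split: split_indicator)
          finally show ?thesis by (simp add: mult_ac)
        qed (simp add: d_def gamma_density_nonpos)
      qed
      also have "\<dots> = L / b ^ n * ((\<alpha> + \<beta>) / R n l)" using gm by simp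
      also have "\<dots> \<le> L / b ^ n * ((\<alpha> + \<beta>) / Rmin n)"
        using L_nonneg b q_pos R_pos[of n l] Rmin_pos[of n] Rmin_le[of n l]
        by (intro mult_left_mono divide_left_mono mult_pos_pos) auto
      finally have 1: "\<bar>LINT x|lborel. d x\<bar> \<le> L / b ^ n * ((\<alpha> + \<beta>) / Rmin n)" .
      have 2: "\<bar>(T n l 0 - h 0) * (S l - mu)\<bar> \<le> real n * (L * \<beta> / u) * r"
        unfolding abs_mult using T_origin[of n l] osc[of l] L_nonneg \<beta> u
        by (intro mult_mono) auto
      show ?thesis unfolding split E_def using 1 2 by linarith
    qed
    \<comment> \<open>Since \<open>mu\<close> is the weighted mean of \<open>S\<close>, the
      subtracted term with \<open>h 0\<close> integrates to zero.\<close>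
    have Gi: "integrable U (\<lambda>l. W n l * (part n A l - mu * part n UNIV l - h 0 * (S l - mu)))"
      and GI: "(LINT l|U. W n l * (part n A l - mu * part n UNIV l - h 0 * (S l - mu))) = J A - mu * J UNIV"
    proof -
      have eq: "W n l * (part n A l - mu * part n UNIV l - h 0 * (S l - mu))
          = W n l * part n A l - mu * (W n l * part n UNIV l) - (h 0 * (W n l * S l) - h 0 * mu * W n l)" for l
        by (simp add: algebra_simps)
      note ii = W_part_integrable[OF A, of n] W_part_integrable[of UNIV n] WS W_integrable[of n]
      show "integrable U (\<lambda>l. W n l * (part n A l - mu * part n UNIV l - h 0 * (S l - mu)))"
        unfolding eq using ii by simp
      have "(LINT l|U. W n l * (part n A l - mu * part n UNIV l - h 0 * (S l - mu)))
         = J A - mu * J UNIV - (h 0 * (mu * m) - h 0 * mu * m)"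
        unfolding eq mS using ii by (simp add: J_def m_def)
      then show "(LINT l|U. W n l * (part n A l - mu * part n UNIV l - h 0 * (S l - mu))) = J A - mu * J UNIV"
        by simp
    qed
    have "\<bar>J A - mu * J UNIV\<bar> \<le> (LINT l|U. W n l * E)"
      unfolding GI[symmetric]
    proof (intro order_trans[OF integral_abs_bound] integral_mono)
      show "\<bar>W n l * (part n A l - mu * part n UNIV l - h 0 * (S l - mu))\<bar> \<le> W n l * E" for l
        using mult_left_mono[OF G[of l], of "W n l"] W_pos[of n l] by (simp add: abs_mult)
    qed (use Gi W_integrable[of n] in auto)
    also have "\<dots> = E * m" by (simp add: m_def mult.commute)
    finally have JA: "\<bar>J A - mu * J UNIV\<bar> \<le> E * m" .
    have JUp: "0 < J UNIV" using JU H m by (meson less_le_trans mult_pos_pos)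
    have "mu - J A / J UNIV = - ((J A - mu * J UNIV) / J UNIV)"
      using JUp by (simp add: diff_divide_distrib)
    then have "\<bar>mu - J A / J UNIV\<bar> = \<bar>J A - mu * J UNIV\<bar> / J UNIV"
      using JUp by (simp only: abs_minus_cancel abs_divide abs_of_pos)
    also have "\<dots> \<le> E * m / (H * m)"
      using JA JU JUp H m by (intro frac_le) auto
    also have "\<dots> = E / H" using m by simp
    finally show ?thesis
      unfolding mu using measure_opt_filter[OF f0 f A, of n] by (simp add: J_def)
  qed
  then show ?thesis unfolding tv_dist_def E_def r_def by (intro cSUP_least) auto
qed

end

lemma tv_dist_bounds:
  assumes "prob_space \<mu>" "prob_space \<nu>"
  shows "0 \<le> tv_dist \<mu> \<nu>" "tv_dist \<mu> \<nu> \<le> 1"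
proof -
  interpret \<mu>: prob_space \<mu> by fact
  interpret \<nu>: prob_space \<nu> by fact
  have le: "\<bar>measure \<mu> A - measure \<nu> A\<bar> \<le> 1" for A
    using \<mu>.prob_le_1[of A] \<nu>.prob_le_1[of A] measure_nonneg[of \<mu> A] measure_nonneg[of \<nu> A]
    by linarith
  show "tv_dist \<mu> \<nu> \<le> 1" unfolding tv_dist_def using le by (intro cSUP_least) auto
  have "\<bar>measure \<mu> {} - measure \<nu> {}\<bar> \<le> tv_dist \<mu> \<nu>" unfolding tv_dist_def
    using le by (intro cSUP_upper bdd_aboveI2[where M = 1]) auto
  then show "0 \<le> tv_dist \<mu> \<nu>" by simp
qed

section \<open>Small observations are unlikely\<close>

lemma distributed_AE_in:
  fixes X :: "'a \<Rightarrow> real"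
  assumes X: "distributed M lborel X f" and A: "A \<in> sets borel" and f: "\<And>x. x \<notin> A \<Longrightarrow> f x = 0"
  shows "AE \<omega> in M. X \<omega> \<in> A"
proof -
  have [measurable]: "X \<in> measurable M lborel" using X by (simp add: distributed_def)
  have "emeasure M (X -` (- A) \<inter> space M) = (\<integral>\<^sup>+x. f x * indicator (- A) x \<partial>lborel)"
    using A by (intro distributed_emeasure[OF X]) auto
  also have "(\<lambda>x. f x * indicator (- A) x) = (\<lambda>x. 0)"
    using f by (auto simp: fun_eq_iff split: split_indicator)
  finally have "emeasure M (X -` (- A) \<inter> space M) = 0" by simp
  then show ?thesis
    using A by (intro AE_I[where N = "X -` (- A) \<inter> space M"]) auto
qed

text \<open>Bounding the exponential by \<open>1\<close> leaves the integral of a power over the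
  interval from \<open>0\<close> to \<open>t\<close>.\<close>

lemma nn_integral_gamma_density_lessThan:
  assumes "r > 0" "t > 0"
  shows "(\<integral>\<^sup>+x. ennreal (gamma_density 1 r x) * indicator {..<t} x \<partial>lborel) \<le> ennreal (t powr r / Gamma (r + 1))"
proof -
  have G: "0 < Gamma r" "Gamma (r + 1) = r * Gamma r"
    using assms Gamma_real_pos[of r] Gamma_plus1[of r] nonpos_Ints_nonpos[of r] by force+
  have i: "((\<lambda>x. x powr (r - 1)) has_integral (t powr r / r)) {0..t}"
    using has_integral_powr_from_0[of "r - 1" t] assms by simp
  have "(\<integral>\<^sup>+x. ennreal (gamma_density 1 r x) * indicator {..<t} x \<partial>lborel)
     \<le> (\<integral>\<^sup>+x. ennreal (1 / Gamma r) * ennreal (indicator {0..t} x * x powr (r - 1)) \<partial>lborel)"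
  proof (rule nn_integral_mono)
    fix x :: real
    show "ennreal (gamma_density 1 r x) * indicator {..<t} x
       \<le> ennreal (1 / Gamma r) * ennreal (indicator {0..t} x * x powr (r - 1))"
    proof (cases "0 < x \<and> x < t")
      case True
      have "x powr (r - 1) * exp (- x) \<le> x powr (r - 1) * 1"
        using True by (intro mult_left_mono) auto
      then have "gamma_density 1 r x \<le> 1 / Gamma r * x powr (r - 1)"
        using True G by (simp add: gamma_density_def divide_right_mono)
      then show ?thesis using True G by (simp add: ennreal_mult'[symmetric] ennreal_leI)
    next
      case False
      then show ?thesis by (auto simp: gamma_density_nonpos not_less split: split_indicator)
    qed
  qed
  also have "\<dots> = ennreal (1 / Gamma r) * (\<integral>\<^sup>+x. ennreal (indicator {0..t} x * x powr (r - 1)) \<partial>lborel)"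
    by (intro nn_integral_cmult) measurable
  also have "(\<integral>\<^sup>+x. ennreal (indicator {0..t} x * x powr (r - 1)) \<partial>lborel) = ennreal (t powr r / r)"
    using nn_integral_has_integral_lebesgue[OF _ i] by simp
  also have "ennreal (1 / Gamma r) * ennreal (t powr r / r) = ennreal (t powr r / Gamma (r + 1))"
    using G assms by (simp add: ennreal_mult'[symmetric] mult_ac)
  finally show ?thesis .
qed

section \<open>Signal and observations in terms of the independent noise variables\<close>

context gamma_beta_hmm
begin

abbreviation "noise \<equiv> case_noise_index (X 0) W G"

text \<open>The signal at time \<open>n\<close> is a product over this index set. Since
  \<open>Obs n\<close> lies outside, its independence of \<open>G n\<close> can be read off the
  single independent family.\<close>

definition signal_noise :: "nat \<Rightarrow> noise_index set" where
  "signal_noise n = insert Init (Signal ` {1..n})"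

text \<open>The signal without its deterministic factor \<open>b ^ n\<close>.\<close>

definition scaled_signal :: "nat \<Rightarrow> 'a \<Rightarrow> real" where
  "scaled_signal n \<omega> = (\<Prod>i\<in>signal_noise n. noise i \<omega>)"

lemma finite_signal_noise [simp]: "finite (signal_noise n)"
  by (simp add: signal_noise_def)

lemma random_variable_noise:
  assumes "n \<ge> 1"
  shows "random_variable borel (X 0)" "random_variable borel (W n)" "random_variable borel (G n)"
  using distr_X0 distr_W[OF assms] distr_G[OF assms] by (auto simp: distributed_def)

lemma scaled_signal_Suc: "scaled_signal (Suc n) \<omega> = scaled_signal n \<omega> * W (Suc n) \<omega>"
proof -
  have "signal_noise (Suc n) = insert (Signal (Suc n)) (signal_noise n)"
    by (auto simp: signal_noise_def atLeastAtMostSuc_conv)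
  moreover have "Signal (Suc n) \<notin> signal_noise n" by (auto simp: signal_noise_def)
  ultimately show ?thesis by (simp add: scaled_signal_def mult.commute)
qed

lemma signal_eq: "\<omega> \<in> space M \<Longrightarrow> X n \<omega> = b ^ n * scaled_signal n \<omega>"
proof (induction n)
  case 0
  then show ?case by (simp add: scaled_signal_def signal_noise_def)
next
  case (Suc n)
  then show ?case using signal[of "Suc n" \<omega>] by (simp add: scaled_signal_Suc)
qed

lemma AE_noise_pos:
  shows AE_W: "n \<ge> 1 \<Longrightarrow> AE \<omega> in M. W n \<omega> \<in> {0<..<1}"
    and AE_G: "n \<ge> 1 \<Longrightarrow> AE \<omega> in M. G n \<omega> \<in> {0<..}"
    and AE_X0: "AE \<omega> in M. X 0 \<omega> \<in> {0<..}"
proof -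
  show "AE \<omega> in M. W n \<omega> \<in> {0<..<1}" if "n \<ge> 1"
    by (rule distributed_AE_in[OF distr_W[OF that]]) (auto simp: beta_density_def)
  show "AE \<omega> in M. G n \<omega> \<in> {0<..}" if "n \<ge> 1"
    by (rule distributed_AE_in[OF distr_G[OF that]]) (auto simp: gamma_density_def)
  show "AE \<omega> in M. X 0 \<omega> \<in> {0<..}"
    by (rule distributed_AE_in[OF distr_X0]) auto
qed

lemma AE_scaled_signal_pos: "AE \<omega> in M. 0 < scaled_signal n \<omega>"
proof (induction n)
  case 0
  then show ?case using AE_X0 by (auto simp: scaled_signal_def signal_noise_def)
next
  case (Suc n)
  have "AE \<omega> in M. W (Suc n) \<omega> \<in> {0<..<1}" by (rule AE_W) simp
  with Suc show ?case by eventually_elim (auto simp: scaled_signal_Suc)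
qed

lemma AE_obs_pos:
  assumes b: "0 < b"
  shows "AE \<omega> in M. \<forall>n\<ge>1. 0 < Y n \<omega>"
proof -
  have "AE \<omega> in M. \<forall>n. n \<ge> 1 \<longrightarrow> 0 < Y n \<omega>"
    unfolding AE_all_countable
  proof
    fix n :: nat
    show "AE \<omega> in M. n \<ge> 1 \<longrightarrow> 0 < Y n \<omega>"
    proof (cases "n \<ge> 1")
      case True
      have "AE \<omega> in M. \<omega> \<in> space M" by simp
      with AE_scaled_signal_pos[of n] AE_G[OF True] show ?thesis
      proof eventually_elim
        case (elim \<omega>)
        then show ?case using observation[OF True elim(3)] signal_eq[OF elim(3), of n] b by auto
      qed
    qed simp
  qed
  then show ?thesis by simp
qed

lemma W_moment:
  assumes \<beta>: "0 < \<beta>" and n: "n \<ge> 1"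
  shows "(\<integral>\<^sup>+\<omega>. ennreal (W n \<omega> powr \<beta>) \<partial>M) = ennreal (LINT \<omega>|M. W 1 \<omega> powr \<beta>)"
    and "0 < (LINT \<omega>|M. W 1 \<omega> powr \<beta>)"
proof -
  note [measurable] = random_variable_noise
  \<comment> \<open>The moment is determined by the density, which is the same for all
    \<open>n \<ge> 1\<close>.\<close>
  have eq: "(\<integral>\<^sup>+\<omega>. ennreal (W n \<omega> powr \<beta>) \<partial>M) = (\<integral>\<^sup>+x. ennreal (beta_density \<alpha> \<beta> x) * ennreal (x powr \<beta>) \<partial>lborel)"
    if "n \<ge> 1" for n
    by (intro distributed_nn_integral[OF distr_W[OF that], symmetric]) measurable
  have W1 [measurable]: "random_variable borel (W 1)" by (rule random_variable_noise) simp
  have int: "integrable M (\<lambda>\<omega>. W 1 \<omega> powr \<beta>)"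
  proof (rule integrable_const_bound[where B = 1])
    show "AE \<omega> in M. norm (W 1 \<omega> powr \<beta>) \<le> 1"
      using AE_W[OF order_refl]
    proof eventually_elim
      case (elim \<omega>)
      then show ?case using \<beta> powr_mono2[of \<beta> "W 1 \<omega>" 1] by auto
    qed
  qed measurable
  have "(\<integral>\<^sup>+\<omega>. ennreal (W 1 \<omega> powr \<beta>) \<partial>M) = ennreal (LINT \<omega>|M. W 1 \<omega> powr \<beta>)"
    by (rule nn_integral_eq_integral[OF int]) simp
  then show "(\<integral>\<^sup>+\<omega>. ennreal (W n \<omega> powr \<beta>) \<partial>M) = ennreal (LINT \<omega>|M. W 1 \<omega> powr \<beta>)"
    using eq[OF n] eq[of 1] by simp
  have "(LINT \<omega>|M. W 1 \<omega> powr \<beta>) \<noteq> 0"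
  proof
    assume "(LINT \<omega>|M. W 1 \<omega> powr \<beta>) = 0"
    then have "AE \<omega> in M. W 1 \<omega> powr \<beta> = 0"
      using integral_nonneg_eq_0_iff_AE[OF int] by simp
    with AE_W[OF order_refl] have "AE \<omega> in M. False" by eventually_elim auto
    then show False by simp
  qed
  moreover have "0 \<le> (LINT \<omega>|M. W 1 \<omega> powr \<beta>)" by (intro Bochner_Integration.integral_nonneg) simp
  ultimately show "0 < (LINT \<omega>|M. W 1 \<omega> powr \<beta>)" by (metis less_le)
qed

lemma scaled_signal_moment:
  assumes \<beta>: "0 < \<beta>"
    and K: "(\<integral>\<^sup>+\<omega>. ennreal (X 0 \<omega> powr \<beta>) \<partial>M) = ennreal K" "0 \<le> K"
  shows "(\<integral>\<^sup>+\<omega>. ennreal (scaled_signal n \<omega> powr \<beta>) \<partial>M) = ennreal (K * (LINT \<omega>|M. W 1 \<omega> powr \<beta>) ^ n)"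
proof -
  define r where "r = (LINT \<omega>|M. W 1 \<omega> powr \<beta>)"
  have r: "0 < r" unfolding r_def using W_moment(2)[OF \<beta> order_refl] .
  have sub: "signal_noise n \<subseteq> {Init} \<union> Signal ` {1..} \<union> Obs ` {1..}" by (auto simp: signal_noise_def)
  have ind: "indep_vars (\<lambda>_. borel) (\<lambda>i \<omega>. ennreal (noise i \<omega> powr \<beta>)) (signal_noise n)"
    by (rule indep_vars_compose2[OF indep_vars_subset[OF indep sub]]) measurable
  have "(\<integral>\<^sup>+\<omega>. ennreal (scaled_signal n \<omega> powr \<beta>) \<partial>M)
      = (\<integral>\<^sup>+\<omega>. (\<Prod>i\<in>signal_noise n. ennreal (noise i \<omega> powr \<beta>)) \<partial>M)"
    by (simp add: scaled_signal_def prod_powr_distrib prod_ennreal)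
  also have "\<dots> = (\<Prod>i\<in>signal_noise n. \<integral>\<^sup>+\<omega>. ennreal (noise i \<omega> powr \<beta>) \<partial>M)"
    by (intro indep_vars_nn_integral ind) auto
  also have "\<dots> = ennreal K * (\<Prod>k\<in>{1..n}. \<integral>\<^sup>+\<omega>. ennreal (W k \<omega> powr \<beta>) \<partial>M)"
  proof -
    have "inj_on Signal {1..n}" by (auto intro: inj_onI)
    then show ?thesis unfolding signal_noise_def using K by (subst prod.insert) (auto simp: prod.reindex)
  qed
  also have "(\<Prod>k\<in>{1..n}. \<integral>\<^sup>+\<omega>. ennreal (W k \<omega> powr \<beta>) \<partial>M) = (\<Prod>k\<in>{1..n}. ennreal r)"
    using W_moment(1)[OF \<beta>] by (intro prod.cong) (auto simp: r_def)
  also have "ennreal K * \<dots> = ennreal (K * r ^ n)"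
    using K r by (simp add: ennreal_mult' ennreal_power)
  finally show ?thesis by (simp add: r_def)
qed

text \<open>Almost surely \<open>b ^ n * Y n\<close> is \<open>G n\<close> divided by the scaled
  signal \<open>?Z\<close>, which is independent of \<open>G n\<close>. For given \<open>?Z\<close>
  the probability of \<open>G n < t * ?Z\<close> is at most
  \<open>(t * ?Z) powr \<beta> / Gamma (\<beta> + 1)\<close>; the expectation of this factorizes
  into the moments of the noise.\<close>

lemma prob_obs_small:
  assumes \<beta>: "0 < \<beta>" and b: "0 < b" and n: "n \<ge> 1" and t: "0 < t"
    and K: "(\<integral>\<^sup>+\<omega>. ennreal (X 0 \<omega> powr \<beta>) \<partial>M) = ennreal K" "0 \<le> K"
  shows "prob {\<omega> \<in> space M. b ^ n * Y n \<omega> < t}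
      \<le> t powr \<beta> * (K * (LINT \<omega>|M. W 1 \<omega> powr \<beta>) ^ n) / Gamma (\<beta> + 1)"
proof -
  let ?Z = "scaled_signal n"
  note [measurable] = random_variable_noise(3)[OF n]
  have Gp: "0 < Gamma (\<beta> + 1)" using \<beta> by (intro Gamma_real_pos) simp
  have sub: "insert (Obs n) (signal_noise n) \<subseteq> {Init} \<union> Signal ` {1..} \<union> Obs ` {1..}"
    using n by (auto simp: signal_noise_def)
  have "Obs n \<notin> signal_noise n" by (auto simp: signal_noise_def)
  then have ind: "indep_var borel (G n) borel ?Z"
    using indep_vars_prod[OF finite_signal_noise, of "Obs n" n noise] indep_vars_subset[OF indep sub]
    by (simp add: scaled_signal_def[abs_def])
  then have Zm [measurable]: "random_variable borel ?Z" by (rule indep_var_rv2)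
  define B where "B = {gz :: real \<times> real. fst gz < t * snd gz}"
  have "{gz \<in> space (borel \<Otimes>\<^sub>M borel). fst gz < t * snd gz} \<in> sets (borel \<Otimes>\<^sub>M (borel :: real measure))"
    by measurable
  then have B: "B \<in> sets (borel \<Otimes>\<^sub>M borel)" by (simp add: B_def space_pair_measure)
  interpret DG: prob_space "distr M borel (G n)" by (rule prob_space_distr) measurable
  interpret DZ: prob_space "distr M borel ?Z" by (rule prob_space_distr) measurable
  interpret P: pair_sigma_finite "distr M borel (G n)" "distr M borel ?Z" ..
  have "emeasure M {\<omega> \<in> space M. G n \<omega> < t * ?Z \<omega>}
      = emeasure (distr M (borel \<Otimes>\<^sub>M borel) (\<lambda>\<omega>. (G n \<omega>, ?Z \<omega>))) B"
    using B by (subst emeasure_distr) (auto simp: B_def intro!: arg_cong[where f = "emeasure M"])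
  also have "\<dots> = emeasure (distr M borel (G n) \<Otimes>\<^sub>M distr M borel ?Z) B"
    using ind by (simp add: indep_var_distribution_eq)
  \<comment> \<open>Sections of \<open>B\<close> at a fixed value \<open>z\<close> of the scaled
    signal are half-lines for \<open>G n\<close>.\<close>
  also have "\<dots> = (\<integral>\<^sup>+z. emeasure (distr M borel (G n)) ((\<lambda>g. (g, z)) -` B) \<partial>distr M borel ?Z)"
    using B by (intro P.emeasure_pair_measure_alt2) (simp cong: sets_pair_measure_cong)
  also have "\<dots> = (\<integral>\<^sup>+\<omega>. emeasure (distr M borel (G n)) {..<t * ?Z \<omega>} \<partial>M)"
  proof -
    have "(\<lambda>g. (g, z)) -` B = {..<t * z}" for z by (auto simp: B_def)
    moreover have "(\<lambda>z. emeasure (distr M borel (G n)) {..<t * z}) \<in> borel_measurable borel"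
    proof -
      have "(\<lambda>z. emeasure (distr M borel (G n)) ((\<lambda>g. (g, z)) -` B)) \<in> borel_measurable (distr M borel ?Z)"
        using B by (intro P.measurable_emeasure_Pair2) (simp cong: sets_pair_measure_cong)
      then show ?thesis by (simp add: calculation)
    qed
    ultimately show ?thesis by (simp add: nn_integral_distr)
  qed
  also have "\<dots> \<le> (\<integral>\<^sup>+\<omega>. ennreal (t powr \<beta> / Gamma (\<beta> + 1)) * ennreal (?Z \<omega> powr \<beta>) \<partial>M)"
  proof (rule nn_integral_mono_AE)
    show "AE \<omega> in M. emeasure (distr M borel (G n)) {..<t * ?Z \<omega>}
        \<le> ennreal (t powr \<beta> / Gamma (\<beta> + 1)) * ennreal (?Z \<omega> powr \<beta>)"
      using AE_scaled_signal_pos[of n]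
    proof eventually_elim
      case (elim \<omega>)
      have "emeasure (distr M borel (G n)) {..<t * ?Z \<omega>}
         = (\<integral>\<^sup>+x. ennreal (gamma_density 1 \<beta> x) * indicator {..<t * ?Z \<omega>} x \<partial>lborel)"
        using distributed_emeasure[OF distr_G[OF n], of "{..<t * ?Z \<omega>}"] by (simp add: emeasure_distr)
      also have "\<dots> \<le> ennreal ((t * ?Z \<omega>) powr \<beta> / Gamma (\<beta> + 1))"
        using \<beta> t elim by (intro nn_integral_gamma_density_lessThan) auto
      also have "\<dots> = ennreal (t powr \<beta> / Gamma (\<beta> + 1)) * ennreal (?Z \<omega> powr \<beta>)"
        using Gp by (simp add: ennreal_mult'[symmetric] powr_mult)
      finally show ?case .
    qed
  qed
  also have "\<dots> = ennreal (t powr \<beta> / Gamma (\<beta> + 1)) * ennreal (K * (LINT \<omega>|M. W 1 \<omega> powr \<beta>) ^ n)"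
    using scaled_signal_moment[OF \<beta> K, of n] by (simp add: nn_integral_cmult)
  also have "\<dots> = ennreal (t powr \<beta> * (K * (LINT \<omega>|M. W 1 \<omega> powr \<beta>) ^ n) / Gamma (\<beta> + 1))"
    using Gp by (subst ennreal_mult'[symmetric]) auto
  finally have le: "emeasure M {\<omega> \<in> space M. G n \<omega> < t * ?Z \<omega>}
     \<le> ennreal (t powr \<beta> * (K * (LINT \<omega>|M. W 1 \<omega> powr \<beta>) ^ n) / Gamma (\<beta> + 1))" .
  \<comment> \<open>The two events are compared almost everywhere because the scaled signal is
    positive only up to a null set.\<close>
  have "emeasure M {\<omega> \<in> space M. b ^ n * Y n \<omega> < t} \<le> emeasure M {\<omega> \<in> space M. G n \<omega> < t * ?Z \<omega>}"
  proof (rule emeasure_mono_AE)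
    have "AE \<omega> in M. \<omega> \<in> space M" by simp
    with AE_scaled_signal_pos[of n]
    show "AE \<omega> in M. \<omega> \<in> {\<omega> \<in> space M. b ^ n * Y n \<omega> < t} \<longrightarrow> \<omega> \<in> {\<omega> \<in> space M. G n \<omega> < t * ?Z \<omega>}"
    proof eventually_elim
      case (elim \<omega>)
      have "b ^ n * Y n \<omega> = G n \<omega> / ?Z \<omega>"
        using observation[OF n elim(2)] signal_eq[OF elim(2), of n] b by (simp add: field_simps)
      then show ?case using elim by (auto simp: divide_less_eq)
    qed
  qed measurable
  with le have "emeasure M {\<omega> \<in> space M. b ^ n * Y n \<omega> < t}
     \<le> ennreal (t powr \<beta> * (K * (LINT \<omega>|M. W 1 \<omega> powr \<beta>) ^ n) / Gamma (\<beta> + 1))"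
    by (rule order_trans[rotated])
  moreover have "0 \<le> t powr \<beta> * (K * (LINT \<omega>|M. W 1 \<omega> powr \<beta>) ^ n) / Gamma (\<beta> + 1)"
    using Gp K W_moment(2)[OF \<beta> order_refl] by (intro divide_nonneg_nonneg mult_nonneg_nonneg) auto
  ultimately show ?thesis by (simp add: emeasure_eq_measure)
qed

end

section \<open>Rate of convergence\<close>

text \<open>The complement of the support is covered by open null sets, and by the Lindelof property
  countably many of them have the same union.\<close>

lemma AE_measure_support:
  fixes \<mu> :: "'a::second_countable_topology measure"
  assumes "sets \<mu> = sets borel"
  shows "AE x in \<mu>. x \<in> measure_support \<mu>"
proof -
  define F where "F = {N. open N \<and> emeasure \<mu> N = 0}"
  obtain F' where F': "F' \<subseteq> F" "countable F'" "\<Union>F' = \<Union>F"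
    by (rule Lindelof[of F]) (auto simp: F_def)
  have "\<Union>F' \<in> null_sets \<mu>"
  proof -
    have "(\<Union>N\<in>F'. N) \<in> null_sets \<mu>"
      using F' assms by (intro null_sets_UN') (auto simp: F_def null_sets_def)
    then show ?thesis by simp
  qed
  moreover have "- measure_support \<mu> \<subseteq> \<Union>F"
    by (auto simp: measure_support_def F_def not_gr_zero)
  ultimately show ?thesis
    unfolding F'(3) by (intro AE_I'[of "\<Union>F"]) auto
qed

text \<open>The tilts are compared with their value at \<open>0\<close>, which lies outside the
  domain of \<open>h\<^sub>0\<close>. Extending by a constant preserves both the Lipschitz constant
  and the lower bound.\<close>

lemma lipschitz_extend_pos:
  fixes h :: "real \<Rightarrow> real"
  assumes h: "L-lipschitz_on {0<..} h" and H: "\<And>x. x > 0 \<Longrightarrow> H \<le> h x"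
  obtains k where "L-lipschitz_on UNIV k" "\<And>x. H \<le> k x" "\<And>x. x > 0 \<Longrightarrow> k x = h x"
proof
  have L: "0 \<le> L" using h by (rule lipschitz_on_nonneg)
  \<comment> \<open>The limit of \<open>h\<close> at \<open>0\<close>, taken as the value on the negative half-line.\<close>
  define a where "a = (INF x\<in>{0<..}. h x + L * x)"
  have lip: "\<bar>h x - h x'\<bar> \<le> L * \<bar>x - x'\<bar>" if "x > 0" "x' > 0" for x x'
    using lipschitz_onD[OF h, of x x'] that by (simp add: dist_real_def)
  have bdd: "bdd_below ((\<lambda>x. h x + L * x) ` {0<..})"
    using H L by (intro bdd_belowI2[where m = H]) (auto intro: add_increasing2)
  have up: "a \<le> h x + L * x" if "x > 0" for x
    unfolding a_def using that by (intro cINF_lower bdd) auto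
  have low: "h x - L * x \<le> a" if x: "x > 0" for x
    unfolding a_def
  proof (rule cINF_greatest)
    fix x' :: real assume x': "x' \<in> {0<..}"
    have "L * \<bar>x - x'\<bar> \<le> L * (x + x')" using L x x' by (intro mult_left_mono) auto
    then show "h x - L * x \<le> h x' + L * x'" using lip[of x x'] x x' by (simp add: algebra_simps)
  qed auto
  have aH: "H \<le> a" unfolding a_def using H L
    by (intro cINF_greatest) (auto intro: add_increasing2)
  let ?k = "\<lambda>x. if x > 0 then h x else a"
  have cross: "\<bar>h x - a\<bar> \<le> L * \<bar>x - x'\<bar>" if "x > 0" "x' \<le> 0" for x x'
  proof -
    have "\<bar>h x - a\<bar> \<le> L * x" using up[of x] low[of x] that by linarith
    also have "\<dots> \<le> L * \<bar>x - x'\<bar>" using L that by (intro mult_left_mono) auto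
    finally show ?thesis .
  qed
  show "L-lipschitz_on UNIV ?k"
  proof (rule lipschitz_onI)
    fix x x' :: real
    show "dist (?k x) (?k x') \<le> L * dist x x'"
      using lip[of x x'] cross[of x x'] cross[of x' x] L
      by (auto simp: dist_real_def abs_minus_commute)
  qed (rule L)
  show "H \<le> ?k x" for x using aH H by simp
qed simp

section \<open>Distance bound in terms of the last observation, and moments of the initial
  mixture\<close>

context gamma_mixture
begin

text \<open>Both error terms are of order \<open>1 / (b ^ n * Rmin n)\<close>: for the second,
  \<open>1 - x powr q \<le> - q * ln x \<le> q * (1 / x - 1)\<close> is applied to
  \<open>x = Rmin n / Rmax n\<close>, where \<open>1 / x - 1\<close> equals
  \<open>(v - u) / P\<close>. Finally \<open>y n\<close> is a summand of
  \<open>Rmin n\<close>.\<close>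

lemma tv_dist_opt_filter_le_obs:
  assumes f0: "\<And>x. x > 0 \<Longrightarrow> f x = C * enn2real (mix 0 x)" and f: "prob_density_pos f"
    and g0: "\<And>x. x > 0 \<Longrightarrow> g x = C' * enn2real (gamma_mixture.mix U lam \<alpha> \<beta> b y (\<lambda>_. 1) 0 x)"
    and g: "prob_density_pos g" and n: "n \<ge> 1"
  shows "tv_dist (measure_pos (opt_filter \<alpha> \<beta> b g y n)) (measure_pos (opt_filter \<alpha> \<beta> b f y n))
     \<le> (\<alpha> + \<beta>) * (L + real n * (L * \<beta> / u) * (v - u)) / H / (b ^ n * y n)"
proof -
  define q where "q = \<alpha> + \<beta>"
  define P where "P = b ^ n * Rmin n"
  have q: "0 < q" using q_pos by (simp add: q_def)
  have uv: "u \<le> v" using lam_ge lam_le by (meson order_trans)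
  have le: "Rmin n \<le> Rmax n" by (intro rate_mono b uv)
  have pos: "0 < Rmin n" "0 < Rmax n" using Rmin_pos[of n] le by auto
  have P: "0 < P" unfolding P_def using b pos by simp
  have "Rmax n - Rmin n = (v - u) / b ^ n"
    using rate_affine[of b y n v] rate_affine[of b y n u] by (simp add: diff_divide_distrib)
  then have "Rmax n = Rmin n + (v - u) / b ^ n" by simp
  then have ratio: "Rmax n / Rmin n - 1 = (v - u) / P"
    using pos by (simp add: P_def add_divide_distrib)
  have "1 + q * ln (Rmin n / Rmax n) \<le> (Rmin n / Rmax n) powr q"
    using pos exp_ge_add_one_self[of "q * ln (Rmin n / Rmax n)"] by (simp add: powr_def)
  moreover have "- ln (Rmin n / Rmax n) \<le> Rmax n / Rmin n - 1"
    using ln_le_minus_one[of "Rmax n / Rmin n"] pos by (simp add: ln_div)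
  then have "q * (- ln (Rmin n / Rmax n)) \<le> q * ((v - u) / P)"
    unfolding ratio using q by (intro mult_left_mono) auto
  ultimately have r: "1 - (Rmin n / Rmax n) powr q \<le> q * ((v - u) / P)" by linarith
  have nn: "0 \<le> real n * (L * \<beta> / u)" using L_nonneg \<beta> u by simp
  have "tv_dist (measure_pos (opt_filter \<alpha> \<beta> b g y n)) (measure_pos (opt_filter \<alpha> \<beta> b f y n))
     \<le> (L / b ^ n * (q / Rmin n) + real n * (L * \<beta> / u) * (1 - (Rmin n / Rmax n) powr q)) / H"
    unfolding q_def by (rule tv_dist_opt_filter_le[OF f0 f g0 g])
  also have "\<dots> \<le> (L / b ^ n * (q / Rmin n) + real n * (L * \<beta> / u) * (q * ((v - u) / P))) / H"
    using r nn H by (intro divide_right_mono add_left_mono mult_left_mono) auto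
  also have "\<dots> = q * (L + real n * (L * \<beta> / u) * (v - u)) / H / P"
  proof -
    define c where "c = real n * (L * \<beta> / u)"
    have e: "L / b ^ n * (q / Rmin n) = q * L / P" by (simp add: P_def)
    show ?thesis
      unfolding c_def[symmetric] e by (simp add: add_divide_distrib distrib_left mult_ac)
  qed
  also have "\<dots> \<le> q * (L + real n * (L * \<beta> / u) * (v - u)) / H / (b ^ n * y n)"
  proof (rule divide_left_mono)
    have "y n \<le> Rmin n" using rate_ge_obs[of b y u n] b y u n by simp
    then show "b ^ n * y n \<le> P" unfolding P_def using b by (intro mult_left_mono) auto
    show "0 \<le> q * (L + real n * (L * \<beta> / u) * (v - u)) / H"
      using q L_nonneg \<beta> u uv H by (intro divide_nonneg_pos mult_nonneg_nonneg add_nonneg_nonneg) auto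
    show "0 < P * (b ^ n * y n)" using P b y[OF n] by simp
  qed
  finally show ?thesis by (simp add: q_def)
qed

text \<open>The tilt grows at most linearly, so the moment is controlled by the moments of orders
  \<open>k\<close> and \<open>k + 1\<close> of the components, which are largest at the smallest
  rate \<open>u\<close>.\<close>

lemma nn_integral_mix_moment_finite:
  assumes k: "0 \<le> k"
  shows "(\<integral>\<^sup>+x. ennreal (x powr k) * mix 0 x \<partial>lborel) < \<infinity>"
proof -
  interpret pair_sigma_finite U lborel ..
  let ?q = "\<alpha> + \<beta>"
  define m where "m j = Gamma (?q + j) / (Gamma ?q * u powr j)" for j
  have "(\<integral>\<^sup>+x. ennreal (x powr k) * mix 0 x \<partial>lborel)
      = (\<integral>\<^sup>+x. \<integral>\<^sup>+l. ennreal (x powr k) * ennreal (kernel 0 l x) \<partial>U \<partial>lborel)"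
    unfolding mix_def by (intro nn_integral_cong nn_integral_cmult[symmetric]) measurable
  also have "\<dots> = (\<integral>\<^sup>+l. \<integral>\<^sup>+x. ennreal (x powr k) * ennreal (kernel 0 l x) \<partial>lborel \<partial>U)"
    by (intro Fubini') measurable
  also have "\<dots> \<le> (\<integral>\<^sup>+l. ennreal \<bar>h 0\<bar> * ennreal (m k) + ennreal L * ennreal (m (k + 1)) \<partial>U)"
  proof (rule nn_integral_mono)
    fix l
    have mono: "Gamma (?q + j) / (Gamma ?q * lam l powr j) \<le> m j" if "0 \<le> j" for j
      unfolding m_def using that q_pos u lam_ge[of l] Gamma_real_pos[of ?q] Gamma_real_pos[of "?q + j"]
      by (intro divide_left_mono mult_left_mono powr_mono2 mult_pos_pos) auto
    have "(\<integral>\<^sup>+x. ennreal (x powr k) * ennreal (kernel 0 l x) \<partial>lborel)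
      \<le> (\<integral>\<^sup>+x. ennreal \<bar>h 0\<bar> * ennreal (x powr k * gamma_density (lam l) ?q x)
           + ennreal L * ennreal (x powr (k + 1) * gamma_density (lam l) ?q x) \<partial>lborel)"
    proof (rule nn_integral_mono)
      fix x :: real
      show "ennreal (x powr k) * ennreal (kernel 0 l x)
          \<le> ennreal \<bar>h 0\<bar> * ennreal (x powr k * gamma_density (lam l) ?q x)
           + ennreal L * ennreal (x powr (k + 1) * gamma_density (lam l) ?q x)"
      proof (cases "x > 0")
        case True
        have g: "0 \<le> gamma_density (lam l) ?q x" using q_pos by (rule gamma_density_nonneg)
        have "x powr k * kernel 0 l x = x powr k * gamma_density (lam l) ?q x * h x"
          by (simp add: kernel_def)
        also have "\<dots> \<le> x powr k * gamma_density (lam l) ?q x * (\<bar>h 0\<bar> + L * x)"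
          using T_upper[of 0 l x] True g by (intro mult_left_mono) auto
        also have "\<dots> = \<bar>h 0\<bar> * (x powr k * gamma_density (lam l) ?q x)
            + L * (x powr (k + 1) * gamma_density (lam l) ?q x)"
          using True by (simp add: powr_add algebra_simps)
        finally have "ennreal (x powr k * kernel 0 l x) \<le> ennreal (\<dots>)" by (rule ennreal_leI)
        also have "\<dots> = ennreal \<bar>h 0\<bar> * ennreal (x powr k * gamma_density (lam l) ?q x)
           + ennreal L * ennreal (x powr (k + 1) * gamma_density (lam l) ?q x)"
          using g L_nonneg by (simp add: ennreal_mult')
        finally show ?thesis by (simp add: ennreal_mult')
      qed (simp add: kernel_nonpos)
    qed
    also have "\<dots> = ennreal \<bar>h 0\<bar> * ennreal (Gamma (?q + k) / (Gamma ?q * lam l powr k))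
        + ennreal L * ennreal (Gamma (?q + (k + 1)) / (Gamma ?q * lam l powr (k + 1)))"
      using k q_pos lam_pos[of l]
      by (simp add: nn_integral_add nn_integral_cmult nn_integral_gamma_density_moment del: of_nat_add)
    also have "\<dots> \<le> ennreal \<bar>h 0\<bar> * ennreal (m k) + ennreal L * ennreal (m (k + 1))"
      using k by (intro add_mono mult_left_mono ennreal_leI mono) auto
    finally show "(\<integral>\<^sup>+x. ennreal (x powr k) * ennreal (kernel 0 l x) \<partial>lborel)
       \<le> ennreal \<bar>h 0\<bar> * ennreal (m k) + ennreal L * ennreal (m (k + 1))" .
  qed
  also have "\<dots> < \<infinity>" by (simp add: emeasure_space_1 ennreal_mult_less_top)
  finally show ?thesis .
qed

end

section \<open>From the pathwise bound to the expectation\<close>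

context gamma_beta_hmm
begin

text \<open>On the event of a small observation \<open>D\<close> is bounded by \<open>1\<close>,
  elsewhere by \<open>\<kappa> * s\<close>.\<close>

lemma expectation_powr_le:
  fixes D :: "'a \<Rightarrow> real"
  assumes D: "AE \<omega> in M. 0 \<le> D \<omega> \<and> D \<omega> \<le> 1 \<and> D \<omega> \<le> \<kappa> / (b ^ n * Y n \<omega>)"
    and \<kappa>: "0 \<le> \<kappa>" and p: "0 < p" and s: "0 < s" and n: "n \<ge> 1"
  shows "(LINT \<omega>|M. D \<omega> powr p) \<le> (\<kappa> * s) powr p + prob {\<omega> \<in> space M. b ^ n * Y n \<omega> < 1 / s}"
proof -
  let ?A = "{\<omega> \<in> space M. b ^ n * Y n \<omega> < 1 / s}"
  \<comment> \<open>\<open>X n\<close> is given only by its recursion, so its measurability is read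
    off the product of noise variables.\<close>
  have [measurable]: "random_variable borel (X n)" "random_variable borel (G n)"
  proof -
    have "random_variable borel (\<lambda>\<omega>. b ^ n * scaled_signal n \<omega>)"
    proof -
      have "random_variable borel (noise i)" if "i \<in> signal_noise n" for i
        using that n random_variable_noise by (auto simp: signal_noise_def)
      then show ?thesis unfolding scaled_signal_def by measurable
    qed
    then show "random_variable borel (X n)"
      by (rule measurable_cong[THEN iffD1, rotated]) (simp add: signal_eq)
    show "random_variable borel (G n)" using n by (rule random_variable_noise)
  qed
  have [measurable]: "random_variable borel (Y n)"
  proof -
    have "random_variable borel (\<lambda>\<omega>. inverse (X n \<omega>) * G n \<omega>)" by measurable
    then show ?thesis by (rule measurable_cong[THEN iffD1, rotated]) (simp add: observation[OF n])
  qed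
  have A: "?A \<in> events" by measurable
  \<comment> \<open>\<open>D\<close> is not known to be measurable. An integrable nonnegative
    majorant suffices, because the integral of a function that is not integrable is \<open>0\<close>
    by convention.\<close>
  have "(LINT \<omega>|M. D \<omega> powr p) \<le> (LINT \<omega>|M. (\<kappa> * s) powr p + indicator ?A \<omega>)"
  proof (rule integral_mono_AE')
    show "integrable M (\<lambda>\<omega>. (\<kappa> * s) powr p + indicator ?A \<omega>)"
      using A by (intro Bochner_Integration.integrable_add integrable_const integrable_real_indicator)
        (auto simp: less_top[symmetric])
    have "AE \<omega> in M. \<omega> \<in> space M" by simp
    with D show "AE \<omega> in M. D \<omega> powr p \<le> (\<kappa> * s) powr p + indicator ?A \<omega>"
    proof eventually_elim
      case (elim \<omega>)
      show ?case
      proof (cases "\<omega> \<in> ?A")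
        case True
        have "D \<omega> powr p \<le> 1 powr p" using elim p by (intro powr_mono2) auto
        then show ?thesis using True by (simp add: add_increasing)
      next
        case False
        then have le: "1 / s \<le> b ^ n * Y n \<omega>" using elim by auto
        have "0 < 1 / s" using s by simp
        then have bY: "0 < b ^ n * Y n \<omega>" using le by (rule less_le_trans)
        have "D \<omega> \<le> \<kappa> / (b ^ n * Y n \<omega>)" using elim by simp
        also have "\<dots> \<le> \<kappa> / (1 / s)"
          using le s \<kappa> bY by (intro divide_left_mono mult_pos_pos[OF bY]) auto
        finally have "D \<omega> powr p \<le> (\<kappa> * s) powr p" using elim p by (intro powr_mono2) auto
        then show ?thesis using False by simp
      qed
    qed
  qed simp
  also have "\<dots> = (\<kappa> * s) powr p + prob ?A"
    using A by (subst Bochner_Integration.integral_add) (auto simp: prob_space less_top[symmetric])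
  finally show ?thesis .
qed

text \<open>
  The choice \<open>s = r powr (n / (p + \<beta>))\<close> balances the two terms of the splitting at \<open>b ^ n * Y n = 1 / s\<close>.
\<close>

lemma expectation_powr_bigo:
  fixes D :: "nat \<Rightarrow> 'a \<Rightarrow> real"
  defines "r \<equiv> (LINT \<omega>|M. W 1 \<omega> powr \<beta>)"
  assumes \<beta>: "0 < \<beta>" and b: "0 < b" and p: "0 < p"
    and D: "\<And>n. n \<ge> 1 \<Longrightarrow> AE \<omega> in M. 0 \<le> D n \<omega> \<and> D n \<omega> \<le> 1 \<and> D n \<omega> \<le> \<kappa> n / (b ^ n * Y n \<omega>)"
    and \<kappa>: "\<And>n. 0 \<le> \<kappa> n" "\<And>n. \<kappa> n \<le> A * exp (p * d / (p + \<beta>) * real n)" and A: "0 \<le> A" and d: "0 \<le> d"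
    and fin: "(\<integral>\<^sup>+\<omega>. ennreal (X 0 \<omega> powr \<beta>) \<partial>M) < \<infinity>"
  shows "(\<lambda>n. LINT \<omega>|M. D n \<omega> powr p) \<in> O(\<lambda>n. ((r * exp (p * d)) powr (p / (p + \<beta>))) ^ n)"
proof -
  define K where "K = enn2real (\<integral>\<^sup>+\<omega>. ennreal (X 0 \<omega> powr \<beta>) \<partial>M)"
  have K: "(\<integral>\<^sup>+\<omega>. ennreal (X 0 \<omega> powr \<beta>) \<partial>M) = ennreal K" "0 \<le> K"
    using fin by (simp_all add: K_def)
  have r: "0 < r" unfolding r_def by (rule W_moment(2)[OF \<beta> order_refl])
  have Gp: "0 < Gamma (\<beta> + 1)" using \<beta> by (intro Gamma_real_pos) simp
  define K' where "K' = K / Gamma (\<beta> + 1)"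
  have K': "0 \<le> K'" using K Gp by (simp add: K'_def)
  define \<theta> where "\<theta> = p / (p + \<beta>)"
  show ?thesis
  proof (rule bigoI[where c = "A powr p + K'"])
    show "\<forall>\<^sub>F n in sequentially. norm (LINT \<omega>|M. D n \<omega> powr p)
       \<le> (A powr p + K') * norm (((r * exp (p * d)) powr (p / (p + \<beta>))) ^ n)"
      using eventually_ge_at_top[of 1]
    proof eventually_elim
      case (elim n)
      define s where "s = r powr (real n / (p + \<beta>))"
      have s: "0 < s" using r by (simp add: s_def)
      \<comment> \<open>\<open>e\<close> is the growth allowed to \<open>\<kappa> n\<close>. Its
        power \<open>e powr p\<close> is exactly the contribution of \<open>exp (p * d)\<close> to
        the rate, as \<open>rho\<close> shows.\<close>
      define e where "e = exp (p * d / (p + \<beta>) * real n)"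
      have e: "1 \<le> e" using p \<beta> d by (simp add: e_def)
      have sp: "s powr p = r powr (\<theta> * real n)"
        by (simp add: s_def powr_powr \<theta>_def mult_ac)
      \<comment> \<open>The exponent is
        \<open>n - n * \<beta> / (p + \<beta>) = n * p / (p + \<beta>)\<close>, the same as in
        \<open>sp\<close>: this is the balance that dictates \<open>s\<close>.\<close>
      have sb: "(1 / s) powr \<beta> * r ^ n = r powr (\<theta> * real n)"
      proof -
        have "(1 / s) powr \<beta> = r powr (- (real n / (p + \<beta>)) * \<beta>)"
          using r by (simp add: s_def powr_minus_divide[symmetric] powr_powr)
        then have "(1 / s) powr \<beta> * r ^ n = r powr (- (real n / (p + \<beta>)) * \<beta> + real n)"
          using r by (simp only: powr_add powr_realpow)
        also have "- (real n / (p + \<beta>)) * \<beta> + real n = \<theta> * real n"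
          using p \<beta> by (simp add: \<theta>_def field_simps)
        finally show ?thesis .
      qed
      have rho: "((r * exp (p * d)) powr (p / (p + \<beta>))) ^ n = r powr (\<theta> * real n) * e powr p"
      proof -
        have "((r * exp (p * d)) powr (p / (p + \<beta>))) ^ n = (r * exp (p * d)) powr (\<theta> * real n)"
          using r by (simp add: \<theta>_def[symmetric] powr_realpow[symmetric] powr_powr)
        also have "\<dots> = r powr (\<theta> * real n) * exp (p * d) powr (\<theta> * real n)"
          using r by (simp add: powr_mult)
        also have "exp (p * d) powr (\<theta> * real n) = e powr p"
          by (simp add: e_def powr_def \<theta>_def mult_ac)
        finally show ?thesis .
      qed
      have "(LINT \<omega>|M. D n \<omega> powr p) \<le> (\<kappa> n * s) powr p + prob {\<omega> \<in> space M. b ^ n * Y n \<omega> < 1 / s}"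
        by (rule expectation_powr_le[OF D \<kappa>(1) p s]) (use elim in auto)
      also have "\<dots> \<le> (A * e) powr p * s powr p + (1 / s) powr \<beta> * (K * r ^ n) / Gamma (\<beta> + 1)"
      proof (rule add_mono)
        have "(\<kappa> n * s) powr p \<le> (A * e * s) powr p"
          using \<kappa>[of n] p s by (intro powr_mono2 mult_right_mono mult_nonneg_nonneg) (auto simp: e_def)
        also have "\<dots> = (A * e) powr p * s powr p" by (simp add: powr_mult)
        finally show "(\<kappa> n * s) powr p \<le> (A * e) powr p * s powr p" .
        show "prob {\<omega> \<in> space M. b ^ n * Y n \<omega> < 1 / s} \<le> (1 / s) powr \<beta> * (K * r ^ n) / Gamma (\<beta> + 1)"
          unfolding r_def by (rule prob_obs_small[OF \<beta> b _ _ K]) (use elim s in auto)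
      qed
      also have "\<dots> = (A powr p * e powr p + K') * r powr (\<theta> * real n)"
        by (simp add: K'_def powr_mult sp sb[symmetric] algebra_simps)
      also have "\<dots> \<le> (A powr p * e powr p + K' * e powr p) * r powr (\<theta> * real n)"
      proof (intro mult_right_mono add_left_mono)
        have "1 \<le> e powr p" using e p by (intro ge_one_powr_ge_zero) auto
        then show "K' \<le> K' * e powr p" using mult_left_mono[of 1 "e powr p" K'] K' by simp
      qed simp
      also have "\<dots> = (A powr p + K') * ((r * exp (p * d)) powr (p / (p + \<beta>))) ^ n"
        unfolding rho by (simp add: algebra_simps)
      finally have "(LINT \<omega>|M. D n \<omega> powr p) \<le> (A powr p + K') * ((r * exp (p * d)) powr (p / (p + \<beta>))) ^ n" .
      moreover have "0 \<le> (LINT \<omega>|M. D n \<omega> powr p)" by (intro Bochner_Integration.integral_nonneg) simp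
      ultimately show ?case by simp
    qed
  qed
qed

end

text \<open>With \<open>u / v \<le> 1 \<le> v / u\<close> the radicand is at least \<open>\<beta> *
  (\<beta> + 1) - 2 * \<beta>\<^sup>2 + \<beta> * (\<beta> + 1) = 2 * \<beta>\<close>. Positivity
  makes the exponential factor in the rate large enough to absorb affine growth when the support is
  a proper interval.\<close>

lemma B_bar_pos:
  assumes "0 < \<beta>" "0 < u" "u < v"
  shows "0 < B_bar \<beta> u v"
proof -
  have "2 * \<beta>\<^sup>2 * u / v \<le> 2 * \<beta>\<^sup>2" using assms by (simp add: divide_le_eq mult_left_mono)
  moreover have "\<beta> * (\<beta> + 1) * 1 \<le> \<beta> * (\<beta> + 1) * (v\<^sup>2 / u\<^sup>2)"
    using assms by (intro mult_left_mono) (auto simp: le_divide_eq power_mono)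
  ultimately have "2 * \<beta> \<le> \<beta> * (\<beta> + 1) - 2 * \<beta>\<^sup>2 * u / v + \<beta> * (\<beta> + 1) * v\<^sup>2 / u\<^sup>2"
    by (simp add: algebra_simps power2_eq_square)
  then have "0 < \<beta> * (\<beta> + 1) - 2 * \<beta>\<^sup>2 * u / v + \<beta> * (\<beta> + 1) * v\<^sup>2 / u\<^sup>2"
    using assms by linarith
  then show ?thesis unfolding B_bar_def using assms by (intro mult_pos_pos) auto
qed

theorem theorem9:
  fixes \<alpha> \<beta> b q c u\<^sub>0 o\<^sub>0 H L p \<rho> :: real
    and \<pi>\<^sub>0 \<pi>t\<^sub>0 h\<^sub>0 :: "real \<Rightarrow> real"
    and U\<^sub>0 :: "real measure"
    and M :: "'a measure"
    and X W G Y :: "nat \<Rightarrow> 'a \<Rightarrow> real"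
  assumes "\<alpha> > 0" and "\<beta> > 0" and "b > 0"
    and q: "q = \<alpha> + \<beta>"
    and "prob_density_pos \<pi>\<^sub>0" and "prob_density_pos \<pi>t\<^sub>0"
    and "prob_space U\<^sub>0" and "sets U\<^sub>0 = sets borel"
    and "0 < u\<^sub>0" and "u\<^sub>0 \<le> o\<^sub>0" and "measure_support U\<^sub>0 = {u\<^sub>0..o\<^sub>0}"
    and "\<And>x. x > 0 \<Longrightarrow>
           \<pi>\<^sub>0 x = c * (x powr (q - 1) * (LINT l|U\<^sub>0. l powr q * exp (- l * x)))"
    and "\<And>x. x > 0 \<Longrightarrow> h\<^sub>0 x = \<pi>t\<^sub>0 x / \<pi>\<^sub>0 x"
    and "L-lipschitz_on {0<..} h\<^sub>0"
    and "H > 0" and "\<And>x. x > 0 \<Longrightarrow> h\<^sub>0 x \<ge> H"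
    and "gamma_beta_hmm M \<alpha> \<beta> b \<pi>t\<^sub>0 X W G Y"
    and "p > 0"
    and "B_bar \<beta> u\<^sub>0 o\<^sub>0 \<noteq> 0 \<Longrightarrow>
           p < - (u\<^sub>0 / B_bar \<beta> u\<^sub>0 o\<^sub>0) * ln (LINT \<omega>|M. W 1 \<omega> powr \<beta>)"
    and \<rho>: "\<rho> = ((LINT \<omega>|M. W 1 \<omega> powr \<beta>) * exp (p * B_bar \<beta> u\<^sub>0 o\<^sub>0 / u\<^sub>0)) powr (p / (p + \<beta>))"
  shows "(\<lambda>n. LINT \<omega>|M.
            tv_dist (measure_pos (opt_filter \<alpha> \<beta> b \<pi>\<^sub>0 (\<lambda>k. Y k \<omega>) n))
                    (measure_pos (opt_filter \<alpha> \<beta> b \<pi>t\<^sub>0 (\<lambda>k. Y k \<omega>) n)) powr p)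
         \<in> O(\<lambda>n. \<rho> ^ n)"
proof -
  note \<alpha> = assms(1) and \<beta> = assms(2) and b = assms(3) and \<pi> = assms(5) and \<pi>t = assms(6)
    and U = assms(7) and setsU = assms(8) and u = assms(9) and uo = assms(10) and supp = assms(11)
    and \<pi>_eq = assms(12) and h0 = assms(13) and lip = assms(14) and H = assms(15) and h0_ge = assms(16)
    and hmm = assms(17) and p = assms(18)
  interpret hmm: gamma_beta_hmm M \<alpha> \<beta> b \<pi>t\<^sub>0 X W G Y by (rule hmm)
  interpret U: prob_space U\<^sub>0 by (rule U)
  obtain h where h: "L-lipschitz_on UNIV h" and h_ge: "\<And>x. H \<le> h x" and h_eq: "\<And>x. x > 0 \<Longrightarrow> h x = h\<^sub>0 x"
    using lipschitz_extend_pos[OF lip h0_ge] by blast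
  \<comment> \<open>Clamping the rate to the support makes all bounds hold everywhere and changes nothing almost everywhere.\<close>
  define lam where "lam l = max u\<^sub>0 (min o\<^sub>0 l)" for l
  have lam_meas [measurable]: "lam \<in> borel_measurable U\<^sub>0"
    unfolding lam_def by (subst measurable_cong_sets[OF setsU refl]) measurable
  have lam_AE: "AE l in U\<^sub>0. lam l = l"
    using AE_measure_support[OF setsU] unfolding supp by eventually_elim (auto simp: lam_def)
  have mixture: "gamma_mixture U\<^sub>0 lam u\<^sub>0 o\<^sub>0 \<alpha> \<beta> b L H y h" if "\<And>n. n \<ge> 1 \<Longrightarrow> 0 < y n" for y
    by unfold_locales (use \<alpha> \<beta> b u uo H h h_ge that in \<open>auto simp: lam_def\<close>)
  \<comment> \<open>The factor \<open>Gamma q\<close> undoes the normalization of the Gamma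
    densities of shape \<open>q\<close>.\<close>
  define C where "C = c * Gamma q"
  have q0: "0 < q" using \<alpha> \<beta> q by simp
  \<comment> \<open>The mixture at time \<open>0\<close> is the same for every \<open>y\<close>,
    which allows one constant \<open>C\<close> for all paths; it serves both densities because the
    tilt is their quotient.\<close>
  have \<pi>_mix: "\<pi>\<^sub>0 x = C * enn2real (gamma_mixture.mix U\<^sub>0 lam \<alpha> \<beta> b y (\<lambda>_. 1) 0 x)"
    and \<pi>t_mix: "\<pi>t\<^sub>0 x = C * enn2real (gamma_mixture.mix U\<^sub>0 lam \<alpha> \<beta> b y h 0 x)"
    if y: "\<And>n. n \<ge> 1 \<Longrightarrow> 0 < y n" and x: "x > 0" for x y
  proof -
    interpret m: gamma_mixture U\<^sub>0 lam u\<^sub>0 o\<^sub>0 \<alpha> \<beta> b L H y h using y by (rule mixture)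
    interpret one: gamma_mixture U\<^sub>0 lam u\<^sub>0 o\<^sub>0 \<alpha> \<beta> b 0 1 y "\<lambda>_. 1" by (rule m.gamma_mixture_const)
    have G: "0 < Gamma q" using q0 by (rule Gamma_real_pos)
    have "(LINT l|U\<^sub>0. gamma_density (lam l) q x) = (LINT l|U\<^sub>0. x powr (q - 1) / Gamma q * (l powr q * exp (- l * x)))"
    proof (rule integral_cong_AE)
      show "AE l in U\<^sub>0. gamma_density (lam l) q x = x powr (q - 1) / Gamma q * (l powr q * exp (- l * x))"
        using lam_AE by eventually_elim (use x in \<open>simp add: gamma_density_def\<close>)
      show "(\<lambda>l. x powr (q - 1) / Gamma q * (l powr q * exp (- l * x))) \<in> borel_measurable U\<^sub>0"
        by (subst measurable_cong_sets[OF setsU refl]) measurable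
    qed measurable
    then have int: "(LINT l|U\<^sub>0. gamma_density (lam l) q x)
        = x powr (q - 1) / Gamma q * (LINT l|U\<^sub>0. l powr q * exp (- l * x))" by simp
    have "(LINT l|U\<^sub>0. gamma_density (lam l) q x) = enn2real (one.mix 0 x)"
      using q0 by (subst integral_eq_nn_integral) (auto simp: one.mix_def one.kernel_def q gamma_density_nonneg)
    then have mix: "enn2real (one.mix 0 x) = x powr (q - 1) / Gamma q * (LINT l|U\<^sub>0. l powr q * exp (- l * x))"
      using int by simp
    show 1: "\<pi>\<^sub>0 x = C * enn2real (one.mix 0 x)"
      unfolding mix \<pi>_eq[OF x] using G by (simp add: C_def)
    have hx: "0 < h x" using h_ge[of x] H by linarith
    have "m.mix 0 x = ennreal (h x) * one.mix 0 x"
    proof -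
      have "m.kernel 0 l x = h x * one.kernel 0 l x" for l by (simp add: m.kernel_def one.kernel_def)
      then show ?thesis unfolding m.mix_def one.mix_def using hx
        by (simp add: ennreal_mult' nn_integral_cmult)
    qed
    \<comment> \<open>If \<open>\<pi>\<^sub>0 x\<close> were \<open>0\<close>, the quotient would be
      \<open>0\<close> by convention, against the lower bound \<open>H\<close>.\<close>
    moreover have "\<pi>\<^sub>0 x \<noteq> 0" using h0[OF x] h0_ge[OF x] H by auto
    then have "\<pi>t\<^sub>0 x = h x * \<pi>\<^sub>0 x" using h0[OF x] h_eq[OF x] by simp
    ultimately show "\<pi>t\<^sub>0 x = C * enn2real (m.mix 0 x)"
      using 1 hx by (simp add: enn2real_mult)
  qed
  \<comment> \<open>The true initial law \<open>\<pi>t\<^sub>0\<close> is a tilted mixture and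
    inherits its moments. The bound is taken with the absolute value of \<open>C\<close>, whose sign
    is not recorded.\<close>
  have fin: "(\<integral>\<^sup>+\<omega>. ennreal (X 0 \<omega> powr \<beta>) \<partial>M) < \<infinity>"
  proof -
    interpret m: gamma_mixture U\<^sub>0 lam u\<^sub>0 o\<^sub>0 \<alpha> \<beta> b L H "\<lambda>_. 1" h by (rule mixture) simp
    have "(\<integral>\<^sup>+\<omega>. ennreal (X 0 \<omega> powr \<beta>) \<partial>M)
        = (\<integral>\<^sup>+x. ennreal (indicator {0<..} x * \<pi>t\<^sub>0 x) * ennreal (x powr \<beta>) \<partial>lborel)"
      by (intro distributed_nn_integral[OF hmm.distr_X0, symmetric]) measurable
    also have "\<dots> \<le> (\<integral>\<^sup>+x. ennreal \<bar>C\<bar> * (ennreal (x powr \<beta>) * m.mix 0 x) \<partial>lborel)"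
    proof (rule nn_integral_mono)
      fix x :: real
      show "ennreal (indicator {0<..} x * \<pi>t\<^sub>0 x) * ennreal (x powr \<beta>)
          \<le> ennreal \<bar>C\<bar> * (ennreal (x powr \<beta>) * m.mix 0 x)"
      proof (cases "x > 0")
        case True
        have "ennreal (\<pi>t\<^sub>0 x) \<le> ennreal (\<bar>C\<bar> * enn2real (m.mix 0 x))"
          using \<pi>t_mix[of "\<lambda>_. 1" x] True
          by (simp, intro ennreal_leI mult_right_mono) auto
        also have "\<dots> = ennreal \<bar>C\<bar> * m.mix 0 x" using m.mix_finite[of 0 x] by (simp add: ennreal_mult')
        finally have "ennreal (\<pi>t\<^sub>0 x) * ennreal (x powr \<beta>) \<le> ennreal \<bar>C\<bar> * m.mix 0 x * ennreal (x powr \<beta>)"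
          by (rule mult_right_mono) simp
        then show ?thesis using True by (simp add: mult_ac)
      qed simp
    qed
    also have "\<dots> = ennreal \<bar>C\<bar> * (\<integral>\<^sup>+x. ennreal (x powr \<beta>) * m.mix 0 x \<partial>lborel)"
      by (intro nn_integral_cmult) measurable
    also have "\<dots> < \<infinity>"
      using m.nn_integral_mix_moment_finite[of \<beta>] \<beta> by (simp add: ennreal_mult_less_top)
    finally show ?thesis .
  qed
  define \<kappa> where "\<kappa> n = q * (L + real n * (L * \<beta> / u\<^sub>0) * (o\<^sub>0 - u\<^sub>0)) / H" for n
  define d where "d = B_bar \<beta> u\<^sub>0 o\<^sub>0 / u\<^sub>0"
  have L: "0 \<le> L" using lip by (rule lipschitz_on_nonneg)
  have \<kappa>0: "0 \<le> \<kappa> n" for n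
    unfolding \<kappa>_def using q0 L \<beta> u uo H
    by (intro divide_nonneg_pos mult_nonneg_nonneg add_nonneg_nonneg) auto
  have d0: "0 \<le> d"
    using B_bar_pos[OF \<beta> u, of o\<^sub>0] u uo by (cases "u\<^sub>0 = o\<^sub>0") (auto simp: d_def B_bar_def)
  \<comment> \<open>For a one-point support \<open>\<kappa>\<close> is constant, matching the
    vanishing exponent. Otherwise the exponent is positive, and
    \<open>real n \<le> exp (\<delta> * real n) / \<delta>\<close> absorbs the linear term.\<close>
  obtain A where A: "0 \<le> A" and \<kappa>A: "\<And>n. \<kappa> n \<le> A * exp (p * d / (p + \<beta>) * real n)"
  proof (cases "u\<^sub>0 = o\<^sub>0")
    case True
    show ?thesis
    proof (rule that[of "\<kappa> 0"])
      fix n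
      have "\<kappa> 0 * 1 \<le> \<kappa> 0 * exp (p * d / (p + \<beta>) * real n)"
        using \<kappa>0[of 0] p \<beta> d0 by (intro mult_left_mono) auto
      then show "\<kappa> n \<le> \<kappa> 0 * exp (p * d / (p + \<beta>) * real n)" using True by (simp add: \<kappa>_def)
    qed (rule \<kappa>0)
  next
    case False
    define \<delta> where "\<delta> = p * d / (p + \<beta>)"
    have \<delta>: "0 < \<delta>" unfolding \<delta>_def d_def using B_bar_pos[OF \<beta> u, of o\<^sub>0] False uo u p \<beta> by auto
    define a where "a = q * L / H"
    define a' where "a' = q * (L * \<beta> / u\<^sub>0) * (o\<^sub>0 - u\<^sub>0) / H"
    have aa: "0 \<le> a" "0 \<le> a'"
      unfolding a_def a'_def using q0 L \<beta> u uo H by (intro divide_nonneg_pos mult_nonneg_nonneg; simp)+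
    show ?thesis
    proof (rule that[of "a + a' / \<delta>"])
      show "0 \<le> a + a' / \<delta>" using aa \<delta> by simp
      fix n
      have "1 + \<delta> * real n \<le> exp (\<delta> * real n)" by (rule exp_ge_add_one_self)
      then have "\<delta> * real n \<le> exp (\<delta> * real n)" by linarith
      then have e: "1 \<le> exp (\<delta> * real n)" "real n \<le> exp (\<delta> * real n) / \<delta>"
        using \<delta> by (simp_all add: pos_le_divide_eq mult.commute)
      have "\<kappa> n = a * 1 + a' * real n" by (simp add: \<kappa>_def a_def a'_def distrib_left add_divide_distrib mult_ac)
      also have "\<dots> \<le> a * exp (\<delta> * real n) + a' * (exp (\<delta> * real n) / \<delta>)"
        using aa e by (intro add_mono mult_left_mono) auto
      also have "\<dots> = (a + a' / \<delta>) * exp (\<delta> * real n)" by (simp add: algebra_simps)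
      finally show "\<kappa> n \<le> (a + a' / \<delta>) * exp (p * d / (p + \<beta>) * real n)" by (simp add: \<delta>_def)
    qed
  qed
  define D where "D n \<omega> = tv_dist (measure_pos (opt_filter \<alpha> \<beta> b \<pi>\<^sub>0 (\<lambda>k. Y k \<omega>) n))
      (measure_pos (opt_filter \<alpha> \<beta> b \<pi>t\<^sub>0 (\<lambda>k. Y k \<omega>) n))" for n \<omega>
  \<comment> \<open>Along almost every path all observations are positive, so the path itself is an
    admissible sequence for \<open>gamma_mixture\<close>.\<close>
  have D: "AE \<omega> in M. 0 \<le> D n \<omega> \<and> D n \<omega> \<le> 1 \<and> D n \<omega> \<le> \<kappa> n / (b ^ n * Y n \<omega>)" if n: "n \<ge> 1" for n
    using hmm.AE_obs_pos[OF b]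
  proof eventually_elim
    case (elim \<omega>)
    interpret m: gamma_mixture U\<^sub>0 lam u\<^sub>0 o\<^sub>0 \<alpha> \<beta> b L H "\<lambda>k. Y k \<omega>" h by (rule mixture) (use elim in simp)
    interpret one: gamma_mixture U\<^sub>0 lam u\<^sub>0 o\<^sub>0 \<alpha> \<beta> b 0 1 "\<lambda>k. Y k \<omega>" "\<lambda>_. 1" by (rule m.gamma_mixture_const)
    have f: "\<pi>t\<^sub>0 x = C * enn2real (m.mix 0 x)" and g: "\<pi>\<^sub>0 x = C * enn2real (one.mix 0 x)" if "x > 0" for x
      using \<pi>_mix[of "\<lambda>k. Y k \<omega>" x] \<pi>t_mix[of "\<lambda>k. Y k \<omega>" x] that elim by auto
    have "D n \<omega> \<le> \<kappa> n / (b ^ n * Y n \<omega>)"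
      unfolding D_def \<kappa>_def q by (rule m.tv_dist_opt_filter_le_obs[OF f \<pi>t g \<pi> n])
    then show ?case
      using tv_dist_bounds[OF one.prob_space_opt_filter[OF g \<pi>, of n] m.prob_space_opt_filter[OF f \<pi>t, of n]]
      by (simp add: D_def)
  qed
  have "(\<lambda>n. LINT \<omega>|M. D n \<omega> powr p)
      \<in> O(\<lambda>n. (((LINT \<omega>|M. W 1 \<omega> powr \<beta>) * exp (p * d)) powr (p / (p + \<beta>))) ^ n)"
    by (rule hmm.expectation_powr_bigo[OF \<beta> b p D \<kappa>0 \<kappa>A A d0 fin])
  then show ?thesis by (simp add: D_def \<rho> d_def)
qed

end
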